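(* Let $G$ be a finite group. Then $\psi(G)\le \mu(G)$. Hence if $G=\mathrm{PSL}_2(p)$ with $p$ a prime, $p\notin\{7,11,19,31\}$, then $\psi(G)\leq 3$, and $\psi(\mathrm{PSL}_2(p))\leq 4$ in the remaining cases, that is, for $p\in\{7,11,19,31\}$.
   Context: For a finite group $G$, $\mu(G)$ denotes the maximum size of a minimal generating set for $G$, that is, a generating set for which no proper subset generates $G$. For $x,y\in G$, write $x\equiv_{\mathrm m} y$ if $x$ and $y$ lie in exactly the same maximal subgroups of $G$. For any positive integer $r$, write $x\equiv_{\mathrm m}^{(r)}y$ if for all $z_1,\ldots,z_{r-1}\in G$ one has $\langle x,z_1,\ldots,z_{r-1}\rangle=G$ if and only if $\langle y,z_1,\ldots,z_{r-1}\rangle=G$. These equivalence relations become finer as $r$ increases and their limit is $\equiv_{\mathrm m}$; $\psi(G)$ denotes the least $r$ such that $\equiv_{\mathrm m}^{(r)}$ coincides with $\equiv_{\mathrm m}$.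
   Formalization: The bound ψ(G) ≤ μ(G) is stated for nontrivial finite groups G only; it fails for the trivial group, where ψ = 1 (r is positive) while μ = 0 (the empty set generates). *)

theory Defs
  imports "HOL-Algebra.Generated_Groups" "HOL-Analysis.Determinants"
    "HOL-Computational_Algebra.Primes"
begin

definition generates :: "('a, 'b) monoid_scheme \<Rightarrow> 'a set \<Rightarrow> bool" where
  "generates G S \<longleftrightarrow> S \<subseteq> carrier G \<and> generate G S = carrier G"

definition minimal_generating_set :: "('a, 'b) monoid_scheme \<Rightarrow> 'a set \<Rightarrow> bool" where
  "minimal_generating_set G S \<longleftrightarrow> generates G S \<and> (\<forall>T. T \<subset> S \<longrightarrow> \<not> generates G T)"

definition mu :: "('a, 'b) monoid_scheme \<Rightarrow> nat" where
  "mu G = Max (card ` {S. minimal_generating_set G S})"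

definition maximal_subgroup :: "('a, 'b) monoid_scheme \<Rightarrow> 'a set \<Rightarrow> bool" where
  "maximal_subgroup G M \<longleftrightarrow> subgroup M G \<and> M \<noteq> carrier G \<and>
     (\<forall>H. subgroup H G \<and> M \<subseteq> H \<longrightarrow> H = M \<or> H = carrier G)"

definition equiv_m :: "('a, 'b) monoid_scheme \<Rightarrow> 'a rel" where
  "equiv_m G = {(x, y). x \<in> carrier G \<and> y \<in> carrier G \<and>
     (\<forall>M. maximal_subgroup G M \<longrightarrow> (x \<in> M \<longleftrightarrow> y \<in> M))}"

(* The list zs holds z_1, ..., z_(r-1).  The relation is only meaningful for r \<ge> 1: since
   subtraction is truncated, the value at r = 0 is the same as at r = 1. *)
definition equiv_m_r :: "('a, 'b) monoid_scheme \<Rightarrow> nat \<Rightarrow> 'a rel" where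
  "equiv_m_r G r = {(x, y). x \<in> carrier G \<and> y \<in> carrier G \<and>
     (\<forall>zs. set zs \<subseteq> carrier G \<and> length zs = r - 1 \<longrightarrow>
        (generates G (insert x (set zs)) \<longleftrightarrow> generates G (insert y (set zs))))}"

definition psi :: "('a, 'b) monoid_scheme \<Rightarrow> nat" where
  "psi G = (LEAST r. 0 < r \<and> equiv_m_r G r = equiv_m G)"

definition special_linear :: "('k::field ^ 'n ^ 'n) monoid" where
  "special_linear = \<lparr>carrier = {A. det A = 1}, monoid.mult = (**), one = mat 1\<rparr>"

definition centre :: "('a, 'b) monoid_scheme \<Rightarrow> 'a set" where
  "centre G = {z \<in> carrier G. \<forall>x\<in>carrier G. z \<otimes>\<^bsub>G\<^esub> x = x \<otimes>\<^bsub>G\<^esub> z}"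

definition PSL2 :: "'k::field itself \<Rightarrow> ('k ^ 2 ^ 2) set monoid" where
  "PSL2 _ = (special_linear :: ('k ^ 2 ^ 2) monoid) Mod
              centre (special_linear :: ('k ^ 2 ^ 2) monoid)"

lemma group_special_linear: "group (special_linear :: ('k::field ^ 'n ^ 'n) monoid)"
proof (rule groupI)
  fix A :: "'k ^ 'n ^ 'n" assume "A \<in> carrier special_linear"
  then have d: "det A = 1" by (simp add: special_linear_def)
  then have "invertible A" by (simp add: invertible_det_nz)
  then obtain B where B: "A ** B = mat 1" "B ** A = mat 1" unfolding invertible_def by blast
  have "det B = 1" using arg_cong[OF B(2), of det] d by (simp add: det_mul)
  with B show "\<exists>B\<in>carrier special_linear. B \<otimes>\<^bsub>special_linear\<^esub> A = \<one>\<^bsub>special_linear\<^esub>"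
    by (auto simp: special_linear_def)
qed (auto simp: special_linear_def det_mul matrix_mul_assoc)

lemma (in group) centre_normal: "centre G \<lhd> G"
proof (rule normalI)
  show "subgroup (centre G) G"
  proof (rule subgroupI)
    fix a assume a: "a \<in> centre G"
    have "inv a \<otimes> x = x \<otimes> inv a" if x: "x \<in> carrier G" for x
    proof -
      have c: "a \<otimes> x = x \<otimes> a" and ac: "a \<in> carrier G" using a x by (auto simp: centre_def)
      have "inv a \<otimes> x = inv a \<otimes> (x \<otimes> a) \<otimes> inv a" using x ac by (simp add: m_assoc)
      also have "\<dots> = inv a \<otimes> (a \<otimes> x) \<otimes> inv a" by (simp add: c)
      also have "\<dots> = x \<otimes> inv a" using x ac by (simp add: m_assoc[symmetric])
      finally show ?thesis .
    qed
    moreover have "a \<in> carrier G" using a by (auto simp: centre_def)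
    ultimately show "inv a \<in> centre G" unfolding centre_def by blast
  next
    fix a b assume ab: "a \<in> centre G" "b \<in> centre G"
    have "(a \<otimes> b) \<otimes> x = x \<otimes> (a \<otimes> b)" if x: "x \<in> carrier G" for x
    proof -
      have c: "a \<otimes> x = x \<otimes> a" "b \<otimes> x = x \<otimes> b" "a \<in> carrier G" "b \<in> carrier G"
        using ab x by (auto simp: centre_def)
      have "(a \<otimes> b) \<otimes> x = (a \<otimes> x) \<otimes> b" using c(2-4) x by (simp add: m_assoc)
      also have "\<dots> = x \<otimes> (a \<otimes> b)"
        unfolding c(1) using c(3,4) x by (simp add: m_assoc)
      finally show ?thesis .
    qed
    moreover have "a \<in> carrier G" "b \<in> carrier G" using ab by (auto simp: centre_def)
    ultimately show "a \<otimes> b \<in> centre G" unfolding centre_def by blast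
  qed (auto simp: centre_def)
  show "\<forall>x\<in>carrier G. centre G #> x = x <# centre G"
    by (auto simp: r_coset_def l_coset_def centre_def)
qed

lemma group_PSL2: "group (PSL2 TYPE('k::field))"
  unfolding PSL2_def
  by (intro normal.factorgroup_is_group group.centre_normal group_special_linear)

(* The trivial group is a genuine exception to psi G \<le> mu G: the relations start at r = 1,
   while the empty set generates. *)
lemma (in group) trivial_group_psi_mu:
  assumes "carrier G = {\<one>}"
  shows "psi G = 1" and "mu G = 0"
proof -
  have e: "generate G {} = carrier G" using assms generate_empty by simp
  have "equiv_m_r G 1 = equiv_m G" using assms by (auto simp: equiv_m_r_def equiv_m_def)
  then show "psi G = 1" unfolding psi_def by (intro Least_equality) auto
  have "{S. minimal_generating_set G S} = {{}}"
    using e by (auto simp: minimal_generating_set_def generates_def)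
  then show "mu G = 0" by (simp add: mu_def)
qed

end

theory Submission
  imports Defs "HOL-Algebra.Multiplicative_Group" "HOL-Algebra.Algebraic_Closure_Type"
    "HOL-Number_Theory.Residues"
begin

unbundle no Formal_Power_Series.fps_syntax

text \<open>
  If \<open>M\<close> is maximal, \<open>y \<notin> M\<close> and \<open>T \<subseteq> M\<close> satisfies \<open>\<langle>T, y\<rangle> = G\<close>, then padding \<open>T\<close> with \<open>1\<close> shows that the relation with
  \<open>r = card T + 1\<close> separates \<open>y\<close> from the elements of \<open>M\<close>. A subset \<open>T\<close> of \<open>M\<close> that is minimal with
  \<open>\<langle>T, y\<rangle> = G\<close> makes \<open>T \<union> {y}\<close> a minimal generating set, whence \<open>psi G \<le> mu G\<close>.

  For \<open>PSL\<^sub>2(p)\<close> no information on \<open>mu\<close> is needed: every proper subgroup is generated by two elements,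
  so \<open>T\<close> can be taken to be a generating pair of \<open>M\<close>, and \<open>psi \<le> 3\<close> for every prime \<open>p\<close>. Let \<open>H\<close> be the preimage in \<open>SL\<^sub>2(p)\<close>
  of a proper subgroup. If \<open>p\<close> divides its order, then up to conjugacy \<open>H\<close> contains all upper unitriangular
  matrices; because these and any matrix that is not upper triangular generate \<open>SL\<^sub>2(p)\<close>, \<open>H\<close> is upper triangular and
  an extension of a group of order \<open>p\<close> by a cyclic one. Otherwise the centralizers of noncentral elements partition \<open>H\<close>
  modulo the centre \<open>Z\<close>, are cyclic modulo \<open>Z\<close> and have index at most two in their normalizers. If \<open>A\<close>
  is the largest of them, either \<open>H\<close> normalizes \<open>A\<close>, or the class equation shows that \<open>card (H/Z)\<close> is determined by
  \<open>card (A/Z)\<close>. In the latter case the same applies to \<open>\<langle>A, g\<rangle>\<close> for any \<open>g\<close> not normalizing \<open>A\<close>, and therefore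
  \<open>H = \<langle>A, g\<rangle>\<close>.
\<close>

section \<open>Maximal subgroups and the invariant psi\<close>

lemma (in group) generates_mono:
  assumes "generates G S" "S \<subseteq> T" "T \<subseteq> carrier G"
  shows "generates G T"
  using assms mono_generate[of S T] generate_incl[of T] unfolding generates_def by blast

text \<open>Finiteness puts a maximal subgroup above every proper one, so a failure to generate is
  always visible inside some \<open>M\<close>.\<close>

lemma (in group) generates_iff_no_maximal:
  assumes fin: "finite (carrier G)" and S: "S \<subseteq> carrier G"
  shows "generates G S \<longleftrightarrow> (\<forall>M. maximal_subgroup G M \<longrightarrow> \<not> S \<subseteq> M)"
proof
  assume "generates G S"
  then show "\<forall>M. maximal_subgroup G M \<longrightarrow> \<not> S \<subseteq> M"
    unfolding generates_def maximal_subgroup_def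
    by (metis generate_subgroup_incl subgroup.subset subset_antisym)
next
  assume R: "\<forall>M. maximal_subgroup G M \<longrightarrow> \<not> S \<subseteq> M"
  show "generates G S"
  proof (rule ccontr)
    assume n: "\<not> generates G S"
    define \<A> where "\<A> = {H. subgroup H G \<and> generate G S \<subseteq> H \<and> H \<noteq> carrier G}"
    have "\<A> \<subseteq> Pow (carrier G)" by (auto simp: \<A>_def dest: subgroup.subset)
    then have "finite \<A>" using fin by (metis finite_Pow_iff finite_subset)
    moreover have "generate G S \<in> \<A>"
      using n S generate_is_subgroup by (auto simp: \<A>_def generates_def)
    ultimately obtain M where M: "M \<in> \<A>" and mx: "\<And>H. H \<in> \<A> \<Longrightarrow> M \<subseteq> H \<Longrightarrow> M = H"
      using finite_has_maximal[of \<A>] by blast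
    have "maximal_subgroup G M"
      unfolding maximal_subgroup_def using M mx by (fastforce simp: \<A>_def)
    moreover have "S \<subseteq> M" using M by (auto simp: \<A>_def intro: generate.incl)
    ultimately show False using R by blast
  qed
qed

text \<open>Generation is decided by which maximal subgroups contain the tuple, and these cannot
  tell \<open>x\<close> from \<open>y\<close>.\<close>

lemma (in group) equiv_m_subset_equiv_m_r:
  assumes "finite (carrier G)"
  shows "equiv_m G \<subseteq> equiv_m_r G r"
  unfolding equiv_m_def equiv_m_r_def by (auto simp: generates_iff_no_maximal[OF assms])

text \<open>Only the inclusion of \<open>equiv_m_r G r\<close> in \<open>equiv_m G\<close> is at
  stake. The criterion serves with \<open>r = mu G\<close> and with \<open>r = 3\<close>.\<close>

lemma (in group) psi_le:
  assumes fin: "finite (carrier G)" and r: "0 < r"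
    and gen: "\<And>M y. maximal_subgroup G M \<Longrightarrow> y \<in> carrier G \<Longrightarrow> y \<notin> M \<Longrightarrow>
      \<exists>T\<subseteq>M. finite T \<and> card T < r \<and> generates G (insert y T)"
  shows "psi G \<le> r"
proof -
  have key: "x \<notin> M"
    if xy: "(x, y) \<in> equiv_m_r G r \<or> (y, x) \<in> equiv_m_r G r"
      and M: "maximal_subgroup G M" and yM: "y \<notin> M" for x y M
  proof
    assume xM: "x \<in> M"
    have y: "y \<in> carrier G" and x: "x \<in> carrier G" using xy by (auto simp: equiv_m_r_def)
    obtain T where T: "T \<subseteq> M" "finite T" "card T < r" "generates G (insert y T)"
      using gen[OF M y yM] by blast
    obtain ts where ts: "set ts = T" "length ts = card T"
      using finite_distinct_list[OF T(2)] distinct_card by metis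
    have sM: "subgroup M G" using M by (simp add: maximal_subgroup_def)
    \<comment> \<open>The relation asks for exactly \<open>r - 1\<close> further elements;
      \<open>card T < r\<close> leaves room, and the identity keeps the tuple inside
      \<open>M\<close>.\<close>
    define zs where "zs = ts @ replicate (r - 1 - card T) \<one>"
    have zs: "set zs \<subseteq> M" "length zs = r - 1" "T \<subseteq> set zs"
      using ts T(1,3) subgroup.one_closed[OF sM] by (auto simp: zs_def)
    have c: "set zs \<subseteq> carrier G" using zs(1) subgroup.subset[OF sM] by blast
    have "generates G (insert y (set zs))"
      using generates_mono[OF T(4), of "insert y (set zs)"] zs(3) y c by auto
    then have "generates G (insert x (set zs))"
      using xy c zs(2) by (auto simp: equiv_m_r_def)
    then show False
      using generates_iff_no_maximal[OF fin, of "insert x (set zs)"] x c M xM zs(1) by auto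
  qed
  have "equiv_m_r G r \<subseteq> equiv_m G"
  proof (rule subrelI)
    fix x y assume xy: "(x, y) \<in> equiv_m_r G r"
    have "x \<in> M \<longleftrightarrow> y \<in> M" if "maximal_subgroup G M" for M
      using key[OF disjI1[OF xy] that] key[OF disjI2[OF xy] that] by blast
    then show "(x, y) \<in> equiv_m G" using xy by (auto simp: equiv_m_def equiv_m_r_def)
  qed
  then have "equiv_m_r G r = equiv_m G" using equiv_m_subset_equiv_m_r[OF fin] by blast
  then show ?thesis unfolding psi_def using r by (intro Least_le) simp
qed

lemma (in group) psi_le_mu:
  assumes fin: "finite (carrier G)" and nt: "carrier G \<noteq> {\<one>}"
  shows "psi G \<le> mu G"
proof (rule psi_le[OF fin])
  have finS: "finite {S. minimal_generating_set G S}"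
    by (rule finite_subset[of _ "Pow (carrier G)"])
      (auto simp: minimal_generating_set_def generates_def fin)
  have le: "card S \<le> mu G" if "minimal_generating_set G S" for S
    unfolding mu_def using finS that by (intro Max_ge) auto
  \<comment> \<open>\<open>P\<close> will be generation, once alone and once after adjoining
    \<open>y\<close>.\<close>
  have ex: "\<exists>Y\<subseteq>S. P Y \<and> (\<forall>T. T \<subset> Y \<longrightarrow> \<not> P T)"
    if "S \<subseteq> carrier G" "P S" for S P
  proof -
    define \<A> where "\<A> = {Y. Y \<subseteq> S \<and> P Y}"
    have "finite \<A>" unfolding \<A>_def using finite_subset[OF that(1) fin] by simp
    moreover have "\<A> \<noteq> {}" using that(2) by (auto simp: \<A>_def)
    ultimately obtain Y where "Y \<in> \<A>" "\<forall>T\<in>\<A>. T \<subseteq> Y \<longrightarrow> Y = T"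
      using finite_has_minimal by metis
    then show ?thesis unfolding \<A>_def by (intro exI[of _ Y]) auto
  qed
  \<comment> \<open>A minimal generating set cannot be empty, because \<open>nt\<close> excludes the
    trivial group.\<close>
  show "0 < mu G"
  proof -
    have "generates G (carrier G)"
      unfolding generates_def using generate_incl[of "carrier G"] by (auto intro: generate.incl)
    then obtain Y where Y: "minimal_generating_set G Y"
      unfolding minimal_generating_set_def using ex[of "carrier G" "generates G"] by blast
    then have g: "Y \<subseteq> carrier G" "generate G Y = carrier G"
      by (simp_all add: minimal_generating_set_def generates_def)
    have "finite Y" using g(1) fin by (rule finite_subset)
    moreover have "Y \<noteq> {}" using g(2) nt generate_empty by metis
    ultimately have "0 < card Y" by (simp add: card_gt_0_iff)
    then show ?thesis using le[OF Y] by simp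
  qed
  fix M y assume M: "maximal_subgroup G M" and y: "y \<in> carrier G" and yM: "y \<notin> M"
  have Mc: "M \<subseteq> carrier G" using M by (simp add: maximal_subgroup_def subgroup.subset)
  have "generates G (insert y M)"
  proof (subst generates_iff_no_maximal[OF fin], use y Mc in blast, intro allI impI notI)
    fix M' assume "maximal_subgroup G M'" "insert y M \<subseteq> M'"
    then show False using M yM unfolding maximal_subgroup_def by blast
  qed
  then obtain T where T: "T \<subseteq> M" "generates G (insert y T)"
    "\<forall>T'. T' \<subset> T \<longrightarrow> \<not> generates G (insert y T')"
    using ex[OF Mc, of "\<lambda>T. generates G (insert y T)"] by blast
  have fT: "finite T" using T(1) Mc fin by (metis finite_subset)
  \<comment> \<open>A proper subset that keeps \<open>y\<close> loses part of \<open>T\<close>,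
    against the minimality of \<open>T\<close>; one without \<open>y\<close> lies in
    \<open>M\<close>.\<close>
  have "minimal_generating_set G (insert y T)"
    unfolding minimal_generating_set_def
  proof (intro conjI allI impI)
    fix T' assume T': "T' \<subset> insert y T"
    show "\<not> generates G T'"
    proof (cases "y \<in> T'")
      case True
      then have "T' = insert y (T' - {y})" "T' - {y} \<subset> T" using T' by auto
      then show ?thesis using T(3) by metis
    next
      case False
      then have "T' \<subseteq> M" using T' T(1) by blast
      then show ?thesis using M Mc generates_iff_no_maximal[OF fin, of T'] by blast
    qed
  qed (rule T(2))
  \<comment> \<open>Hence the set is one larger than \<open>T\<close>, which gives the strict
    inequality \<open>card T < mu G\<close>.\<close>
  moreover have "y \<notin> T" using T(1) yM by blast
  ultimately show "\<exists>T\<subseteq>M. finite T \<and> card T < mu G \<and> generates G (insert y T)"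
    using le[of "insert y T"] fT T(1,2) by (intro exI[of _ T]) auto
qed

section \<open>Finite groups with abelian centralizers\<close>

lemma one_divide_le: "0 < k \<Longrightarrow> k \<le> n \<Longrightarrow> 1 / real n \<le> 1 / real k"
  by (simp add: frac_le)

text \<open>The case of two classes, with index 1 at the largest order \<open>n\<close> and index 2
  at \<open>m\<close>. Positivity of the right side forces \<open>1/n > 1/4\<close>;
  \<open>(3, 12)\<close> belongs to the tetrahedral group.\<close>

lemma unit_fractions_dihedral_tetrahedral:
  fixes n m h :: nat
  assumes "2 \<le> m" "m \<le> n" "0 < h" and eq: "1 / real n + 1 / (2 * real m) - 1 / 2 = 1 / real h"
  shows "(n, h) \<in> {(2, 4), (3, 12)}"
proof -
  have pos: "0 < 1 / real h" using assms(3) by simp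
  have "n \<le> 3"
  proof (rule ccontr)
    assume "\<not> n \<le> 3"
    then have "1 / real n \<le> 1 / 4" "1 / real m \<le> 1 / 2"
      using one_divide_le[of 4 n] one_divide_le[of 2 m] assms(1) by auto
    then show False using eq pos by simp
  qed
  then have "n = 2 \<and> m = 2 \<or> n = 3 \<and> m = 2 \<or> n = 3 \<and> m = 3" using assms by auto
  then show ?thesis using eq pos assms(3) by (auto simp: field_simps)
qed

text \<open>The case of two classes, with index 2 at the largest order \<open>n\<close> and index 1
  at \<open>m\<close>. For \<open>m \<ge> 3\<close> the left side is at most
  \<open>1/6 + 1/3 - 1/2 = 0\<close>, and \<open>m = 2\<close> is the dihedral solution.\<close>

lemma unit_fractions_dihedral:
  fixes n m h :: nat
  assumes "2 \<le> m" "m \<le> n" "0 < h" and eq: "1 / (2 * real n) + 1 / real m - 1 / 2 = 1 / real h"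
  shows "h = 2 * n"
proof -
  have pos: "0 < 1 / real h" using assms(3) by simp
  have "m \<le> 2"
  proof (rule ccontr)
    assume "\<not> m \<le> 2"
    then have "1 / real n \<le> 1 / 3" "1 / real m \<le> 1 / 3"
      using one_divide_le[of 3 n] one_divide_le[of 3 m] assms(2) by auto
    then show False using eq pos by simp
  qed
  then have "1 / real (2 * n) = 1 / real h" using eq assms(1) by simp
  then have "real (2 * n) = real h" using assms(1,2,3) by (simp add: field_simps)
  then show ?thesis by linarith
qed

text \<open>The case of three classes of index 2, as for finite rotation groups. Of the triples with
  positive left side, \<open>2 * n < h\<close> removes the dihedral \<open>(2, 2, n)\<close>; there
  remain \<open>(2, 3, 3)\<close>, \<open>(2, 3, 4)\<close> and \<open>(2, 3, 5)\<close>.\<close>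

lemma unit_fractions_three:
  fixes n m k h :: nat
  assumes "2 \<le> m" "m \<le> k" "k \<le> n" "0 < h" "2 * n < h"
    and eq: "1 / real n + 1 / real m + 1 / real k - 1 = 2 / real h"
  shows "(n, h) \<in> {(3, 12), (4, 24), (5, 60)}"
proof -
  have pos: "0 < 2 / real h" using assms(4) by simp
  have "m \<le> 2"
  proof (rule ccontr)
    assume "\<not> m \<le> 2"
    then have "1 / real n \<le> 1 / 3" "1 / real m \<le> 1 / 3" "1 / real k \<le> 1 / 3"
      using one_divide_le[of 3 n] one_divide_le[of 3 m] one_divide_le[of 3 k] assms(2,3) by auto
    then show False using eq pos by simp
  qed
  then have m: "m = 2" using assms(1) by simp
  have "k \<noteq> 2"
  proof
    assume "k = 2"
    then have "1 / real n = 2 / real h" using eq m by simp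
    then have "real h = 2 * real n" using frac_eq_eq[of "real n" "real h" 1 2] assms(1-4) by simp
    then show False using assms(5) by linarith
  qed
  moreover have "k \<le> 3"
  proof (rule ccontr)
    assume "\<not> k \<le> 3"
    then have "1 / real n \<le> 1 / 4" "1 / real k \<le> 1 / 4"
      using one_divide_le[of 4 n] one_divide_le[of 4 k] assms(3) by auto
    then show False using eq pos m by simp
  qed
  ultimately have k: "k = 3" using assms(1,2) m by linarith
  have eq': "1 / real n - 1 / 6 = 2 / real h" using eq m k by simp
  have "n \<le> 5"
  proof (rule ccontr)
    assume "\<not> n \<le> 5"
    then have "1 / real n \<le> 1 / 6" using one_divide_le[of 6 n] by auto
    then show False using eq' pos by simp
  qed
  then have "n = 3 \<or> n = 4 \<or> n = 5" using assms(3) k by auto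
  then show ?thesis using eq' assms(4) by (auto simp: field_simps)
qed

text \<open>The hypothesis \<open>sum\<close> is the class equation of a group of order \<open>\<eta>\<close> partitioned by conjugates of subgroups
  of order \<open>\<alpha> c\<close> and index \<open>e c\<close> in their normalizers. It admits dihedral solutions and those of the groups
  \<open>A\<^sub>4\<close>, \<open>S\<^sub>4\<close>, \<open>A\<^sub>5\<close>; \<open>lt\<close> excludes the former up to the numerical artefact \<open>(2, 4)\<close>.\<close>
lemma polyhedral_orders:
  fixes \<alpha> e :: "'i \<Rightarrow> nat" and \<eta> :: nat
  assumes fin: "finite Q" and c0: "c0 \<in> Q"
    and \<alpha>: "\<And>c. c \<in> Q \<Longrightarrow> 2 \<le> \<alpha> c" and mx: "\<And>c. c \<in> Q \<Longrightarrow> \<alpha> c \<le> \<alpha> c0"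
    and e: "\<And>c. c \<in> Q \<Longrightarrow> e c = 1 \<or> e c = 2" and le: "\<And>c. c \<in> Q \<Longrightarrow> e c * \<alpha> c \<le> \<eta>"
    and lt: "e c0 * \<alpha> c0 < \<eta>"
    and sum: "(\<Sum>c\<in>Q. (1 - 1 / real (\<alpha> c)) / real (e c)) = 1 - 1 / real \<eta>"
  shows "(\<alpha> c0, \<eta>) \<in> {(2, 4), (3, 12), (4, 24), (5, 60)}"
proof -
  define w where "w c = (1 - 1 / real (\<alpha> c)) / real (e c)" for c
  have h0: "0 < \<eta>" using lt by simp
  have half: "1 / real (\<alpha> c) \<le> 1 / 2" if "c \<in> Q" for c
    using one_divide_le[of 2 "\<alpha> c"] \<alpha>[OF that] by simp
  have w1: "w c = 1 - 1 / real (\<alpha> c)" if "e c = 1" for c using that by (simp add: w_def)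
  have w2: "w c = 1 / 2 - 1 / (2 * real (\<alpha> c))" if "e c = 2" for c
    using that by (simp add: w_def field_simps)
  \<comment> \<open>As the weights sum to less than 1, this leaves at most three classes.\<close>
  have quarter: "1 / 4 \<le> w c" if "c \<in> Q" for c
    using e[OF that] half[OF that] w1[of c] w2[of c] by auto
  have s: "(\<Sum>c\<in>Q. w c) = 1 - 1 / real \<eta>" using sum by (simp add: w_def)
  have "real (card Q) * (1 / 4) \<le> (\<Sum>c\<in>Q. w c)" using sum_bounded_below[of Q "1/4" w] quarter by simp
  moreover have pos: "0 < 1 / real \<eta>" using h0 by simp
  ultimately have "card Q < 4" using s by linarith
  define Q' where "Q' = Q - {c0}"
  have s': "w c0 + (\<Sum>c\<in>Q'. w c) = 1 - 1 / real \<eta>"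
    using s sum.remove[OF fin c0, of w] by (simp add: Q'_def)
  have Q': "finite Q'" "card Q' \<le> 2" "Q' \<subseteq> Q"
    using fin c0 \<open>card Q < 4\<close> by (auto simp: Q'_def)
  have e0: "e c0 = 1 \<or> e c0 = 2" using e c0 by blast
  consider "card Q' = 0" | "card Q' = 1" | "card Q' = 2" using Q'(2) by linarith
  then show ?thesis
  proof cases
    case 1
    \<comment> \<open>A single class leaves \<open>\<alpha> c0 = \<eta>\<close> or
      \<open>\<eta> \<le> 2\<close>, both against \<open>lt\<close>.\<close>
    then have q: "w c0 = 1 - 1 / real \<eta>" using s' Q'(1) by simp
    show ?thesis
    proof (cases "e c0 = 1")
      case True
      then have "real (\<alpha> c0) = real \<eta>" using q w1[OF True] \<alpha>[OF c0] h0 by (simp add: field_simps)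
      then show ?thesis using lt True by simp
    next
      case False
      then have "w c0 \<le> 1 / 2" using w2[of c0] e0 by simp
      then have "1 / 2 \<le> 1 / real \<eta>" using q by simp
      moreover have "2 < \<eta>" using lt False e0 \<alpha>[OF c0] by auto
      ultimately show ?thesis by (simp add: field_simps)
    qed
  next
    case 2
    then obtain c1 where c1: "Q' = {c1}" by (auto simp: card_1_singleton_iff)
    then have q: "w c0 + w c1 = 1 - 1 / real \<eta>" and c1Q: "c1 \<in> Q" using s' Q'(3) by auto
    note b = \<alpha>[OF c1Q] mx[OF c1Q] h0
    consider "e c0 = 1" "e c1 = 1" | "e c0 = 1" "e c1 = 2" | "e c0 = 2" "e c1 = 1"
      | "e c0 = 2" "e c1 = 2" using e0 e[OF c1Q] by blast
    then show ?thesis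
    proof cases
      case 1
      \<comment> \<open>Both weights would be at least \<open>1/2\<close>, while their sum is below
        1.\<close>
      then show ?thesis using q w1 half[OF c0] half[OF c1Q] pos by simp
    next
      case 2
      then show ?thesis using q w1[OF 2(1)] w2[OF 2(2)] unit_fractions_dihedral_tetrahedral[OF b] by auto
    next
      case 3
      then show ?thesis using q w1[OF 3(2)] w2[OF 3(1)] unit_fractions_dihedral[OF b] lt 3(1) by auto
    next
      case 4
      \<comment> \<open>Here \<open>1/(2 * \<alpha> c0) + 1/(2 * \<alpha> c1) = 1/\<eta>\<close>,
        yet by \<open>le\<close> each summand alone is at least \<open>1/\<eta>\<close>.\<close>
      have "1 / real \<eta> \<le> 1 / (2 * real (\<alpha> c0))" "1 / real \<eta> \<le> 1 / (2 * real (\<alpha> c1))"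
        using one_divide_le[of "2 * \<alpha> c0" \<eta>] one_divide_le[of "2 * \<alpha> c1" \<eta>] le[OF c0] le[OF c1Q] 4 b
        by auto
      then show ?thesis using q w2 4 pos by simp
    qed
  next
    case 3
    then obtain c1 c2 where c12: "Q' = {c1, c2}" "c1 \<noteq> c2" by (meson card_2_iff)
    then have q: "w c0 + w c1 + w c2 = 1 - 1 / real \<eta>" and cQ: "c1 \<in> Q" "c2 \<in> Q" using s' Q'(3) by auto
    \<comment> \<open>One class of index 1 next to two weights of at least \<open>1/4\<close> would
      already reach 1, so all indices are 2.\<close>
    have big: "1 / 2 \<le> w c" if "c \<in> Q" "e c = 1" for c using half[OF that(1)] w1[OF that(2)] by simp
    have E: "e c0 = 2" "e c1 = 2" "e c2 = 2"
      using big[OF c0] big[OF cQ(1)] big[OF cQ(2)] quarter[OF c0] quarter[OF cQ(1)] quarter[OF cQ(2)]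
        q pos e[OF c0] e[OF cQ(1)] e[OF cQ(2)] by linarith+
    have q': "1 / real (\<alpha> c0) + 1 / real (\<alpha> c1) + 1 / real (\<alpha> c2) - 1 = 2 / real \<eta>"
      using q w2[OF E(1)] w2[OF E(2)] w2[OF E(3)] by simp
    have "2 * \<alpha> c0 < \<eta>" using lt E by simp
    then show ?thesis
      using unit_fractions_three[of "\<alpha> c1" "\<alpha> c2" "\<alpha> c0" \<eta>] unit_fractions_three[of "\<alpha> c2" "\<alpha> c1" "\<alpha> c0" \<eta>]
        \<alpha>[OF cQ(1)] \<alpha>[OF cQ(2)] mx[OF cQ(1)] mx[OF cQ(2)] h0 q' by (cases "\<alpha> c1 \<le> \<alpha> c2") auto
  qed
qed

section \<open>Commuting, conjugation and the partition into centralizers\<close>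

definition commutes :: "('a, 'b) monoid_scheme \<Rightarrow> 'a \<Rightarrow> 'a \<Rightarrow> bool" where
  "commutes G x y \<longleftrightarrow> x \<otimes>\<^bsub>G\<^esub> y = y \<otimes>\<^bsub>G\<^esub> x"

lemma commutes_refl [simp]: "commutes G x x"
  by (simp add: commutes_def)

lemma commutes_sym: "commutes G x y \<longleftrightarrow> commutes G y x"
  by (auto simp: commutes_def)

definition conjugate :: "('a, 'b) monoid_scheme \<Rightarrow> 'a \<Rightarrow> 'a \<Rightarrow> 'a" where
  "conjugate G g x = g \<otimes>\<^bsub>G\<^esub> x \<otimes>\<^bsub>G\<^esub> inv\<^bsub>G\<^esub> g"

context group
begin

lemma conjugate_closed [simp, intro]:
  "g \<in> carrier G \<Longrightarrow> x \<in> carrier G \<Longrightarrow> conjugate G g x \<in> carrier G"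
  by (simp add: conjugate_def)

lemma conjugate_mult:
  "g \<in> carrier G \<Longrightarrow> h \<in> carrier G \<Longrightarrow> x \<in> carrier G \<Longrightarrow>
    conjugate G (g \<otimes> h) x = conjugate G g (conjugate G h x)"
  by (simp add: conjugate_def m_assoc inv_mult_group)

lemma conjugate_one [simp]: "x \<in> carrier G \<Longrightarrow> conjugate G \<one> x = x"
  by (simp add: conjugate_def)

lemma conjugate_inv_conjugate [simp]:
  "g \<in> carrier G \<Longrightarrow> x \<in> carrier G \<Longrightarrow> conjugate G (inv g) (conjugate G g x) = x"
  "g \<in> carrier G \<Longrightarrow> x \<in> carrier G \<Longrightarrow> conjugate G g (conjugate G (inv g) x) = x"
  by (simp_all flip: conjugate_mult)

lemma conjugate_distrib:
  assumes "g \<in> carrier G" "x \<in> carrier G" "y \<in> carrier G"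
  shows "conjugate G g (x \<otimes> y) = conjugate G g x \<otimes> conjugate G g y"
proof -
  have "inv g \<otimes> (g \<otimes> u) = u" if "u \<in> carrier G" for u
    using assms that by (simp flip: m_assoc)
  then show ?thesis using assms by (simp add: conjugate_def m_assoc)
qed

lemma conjugate_eq_iff [simp]:
  "g \<in> carrier G \<Longrightarrow> x \<in> carrier G \<Longrightarrow> y \<in> carrier G \<Longrightarrow>
    conjugate G g x = conjugate G g y \<longleftrightarrow> x = y"
  by (metis conjugate_inv_conjugate(1))

lemma commutes_conjugate [simp]:
  "g \<in> carrier G \<Longrightarrow> x \<in> carrier G \<Longrightarrow> y \<in> carrier G \<Longrightarrow>
    commutes G (conjugate G g x) (conjugate G g y) \<longleftrightarrow> commutes G x y"
  unfolding commutes_def by (metis conjugate_distrib conjugate_eq_iff m_closed)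

lemma conjugate_fixed_iff:
  "g \<in> carrier G \<Longrightarrow> x \<in> carrier G \<Longrightarrow> conjugate G g x = x \<longleftrightarrow> commutes G x g"
  unfolding commutes_def by (metis conjugate_def inv_solve_right m_closed)

end

text \<open>\<open>abelian\<close> makes commuting transitive outside \<open>Z\<close>, and
  \<open>two_conjugates\<close> bounds the normalizer index of a centralizer by two.
  \<open>Z\<close> is a parameter, not the centre itself, so that the same \<open>Z\<close> serves
  for every subgroup above it.\<close>

locale abelian_centralizer_group = group +
  fixes Z :: "'a set"
  assumes fin: "finite (carrier G)"
    and Z: "subgroup Z G"
    and central: "\<And>z x. z \<in> Z \<Longrightarrow> x \<in> carrier G \<Longrightarrow> commutes G z x"
    and abelian: "\<And>x y w. x \<in> carrier G - Z \<Longrightarrow> y \<in> carrier G \<Longrightarrow> w \<in> carrier G \<Longrightarrow>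
      commutes G x y \<Longrightarrow> commutes G x w \<Longrightarrow> commutes G y w"
    and two_conjugates: "\<And>x. x \<in> carrier G - Z \<Longrightarrow> \<exists>x'. \<forall>g\<in>carrier G.
      commutes G x (conjugate G g x) \<longrightarrow> conjugate G g x \<in> {x, x'}"
begin

definition cent :: "'a \<Rightarrow> 'a set" where "cent x = {y \<in> carrier G. commutes G x y}"

text \<open>For \<open>x \<notin> Z\<close> this is the normalizer of \<open>cent x\<close>, since commuting is transitive outside \<open>Z\<close>.\<close>
definition cent_stab :: "'a \<Rightarrow> 'a set" where "cent_stab x = {g \<in> carrier G. commutes G x (conjugate G g x)}"

text \<open>The class of \<open>x\<close> is the union of the conjugates of \<open>cent x - Z\<close>.\<close>
definition fusion :: "'a rel" where
  "fusion = {(x, y). x \<in> carrier G - Z \<and> y \<in> carrier G - Z \<and>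
    (\<exists>g\<in>carrier G. commutes G (conjugate G g x) y)}"

lemma Z_carrier: "z \<in> Z \<Longrightarrow> z \<in> carrier G" using subgroup.subset[OF Z] by blast

lemma conjugate_Z_iff [simp]:
  assumes "g \<in> carrier G" "x \<in> carrier G"
  shows "conjugate G g x \<in> Z \<longleftrightarrow> x \<in> Z"
  using assms central conjugate_fixed_iff conjugate_inv_conjugate(1)
  by (metis Z_carrier inv_closed)

lemma commutes_trans:
  "x \<in> carrier G \<Longrightarrow> y \<in> carrier G \<Longrightarrow> y \<notin> Z \<Longrightarrow> w \<in> carrier G \<Longrightarrow>
    commutes G x y \<Longrightarrow> commutes G y w \<Longrightarrow> commutes G x w"
  using abelian[of y x w] by (auto simp: commutes_sym[of _ y x])

lemma cent_subgroup:
  assumes x: "x \<in> carrier G"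
  shows "subgroup (cent x) G"
proof (rule subgroupI)
  have iff: "y \<in> cent x \<longleftrightarrow> y \<in> carrier G \<and> conjugate G y x = x" for y
    using x by (auto simp: cent_def conjugate_fixed_iff)
  show "cent x \<subseteq> carrier G" by (auto simp: cent_def)
  show "cent x \<noteq> {}" using x by (auto simp: cent_def)
  show "inv a \<in> cent x" if "a \<in> cent x" for a
    using that x unfolding iff by (metis conjugate_inv_conjugate(1) inv_closed)
  show "a \<otimes> b \<in> cent x" if "a \<in> cent x" "b \<in> cent x" for a b
    using that x unfolding iff by (simp add: conjugate_mult)
qed

lemma Z_subset_cent: "x \<in> carrier G \<Longrightarrow> Z \<subseteq> cent x"
  using central Z_carrier by (auto simp: cent_def commutes_sym[of G x])

text \<open>By \<open>two_conjugates\<close> an element of \<open>cent_stab x\<close> sends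
  \<open>x\<close> to itself or to one other element; the former make up \<open>cent x\<close>, the
  latter a single coset of it.\<close>

lemma cent_stab_cases:
  assumes x: "x \<in> carrier G - Z"
  obtains "cent_stab x = cent x"
  | g where "g \<in> cent_stab x" "cent_stab x = cent x \<union> (\<lambda>y. g \<otimes> y) ` cent x" "cent x \<inter> (\<lambda>y. g \<otimes> y) ` cent x = {}"
proof (cases "cent_stab x = cent x")
  case False
  have xc: "x \<in> carrier G" using x by simp
  have iff: "y \<in> cent x \<longleftrightarrow> y \<in> carrier G \<and> conjugate G y x = x" for y
    using xc by (auto simp: cent_def conjugate_fixed_iff)
  have CN: "cent x \<subseteq> cent_stab x" unfolding iff cent_stab_def subset_iff by simp
  then obtain g where g: "g \<in> cent_stab x" "g \<notin> cent x" using False by blast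
  obtain x' where x': "\<And>g. g \<in> cent_stab x \<Longrightarrow> conjugate G g x \<in> {x, x'}"
    using two_conjugates[OF x] unfolding cent_stab_def by blast
  have gc: "g \<in> carrier G" using g by (simp add: cent_stab_def)
  have gx: "conjugate G g x = x'" "x' \<noteq> x" using x'[OF g(1)] g(2) gc unfolding iff by auto
  have "cent x \<union> (\<lambda>y. g \<otimes> y) ` cent x \<subseteq> cent_stab x"
    using CN g(1) gc xc by (auto simp: iff cent_stab_def conjugate_mult)
  moreover have "h \<in> (\<lambda>y. g \<otimes> y) ` cent x" if h: "h \<in> cent_stab x" "h \<notin> cent x" for h
  proof -
    have hc: "h \<in> carrier G" using h by (simp add: cent_stab_def)
    have "conjugate G h x = x'" using x'[OF h(1)] h(2) hc unfolding iff by auto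
    then have "conjugate G (inv g \<otimes> h) x = conjugate G (inv g) (conjugate G g x)"
      using gx(1) gc hc xc by (simp only: conjugate_mult inv_closed)
    then have "conjugate G (inv g \<otimes> h) x = x" using gc xc by simp
    then have "inv g \<otimes> h \<in> cent x" using gc hc unfolding iff by simp
    moreover have "h = g \<otimes> (inv g \<otimes> h)" using gc hc by (simp flip: m_assoc)
    ultimately show ?thesis by blast
  qed
  moreover have "cent x \<inter> (\<lambda>y. g \<otimes> y) ` cent x = {}"
    using gc xc gx by (auto simp: iff conjugate_mult)
  ultimately show ?thesis using that(2)[OF g(1)] by blast
qed (use that in blast)

lemma finite_sets [simp]: "finite (cent x)" "finite (cent_stab x)" "finite Z"
  using fin finite_subset[OF subgroup.subset[OF Z]] by (simp_all add: cent_def cent_stab_def)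

lemma card_cent_stab:
  assumes x: "x \<in> carrier G - Z"
  shows "card (cent_stab x) = card (cent x) \<or> card (cent_stab x) = 2 * card (cent x)"
proof (rule cent_stab_cases[OF x])
  fix g assume g: "g \<in> cent_stab x" "cent_stab x = cent x \<union> (\<lambda>y. g \<otimes> y) ` cent x" "cent x \<inter> (\<lambda>y. g \<otimes> y) ` cent x = {}"
  have "inj_on (\<lambda>y. g \<otimes> y) (cent x)" using g(1) by (auto simp: cent_stab_def cent_def inj_on_def)
  then show ?thesis using g(2,3) by (simp add: card_Un_disjoint card_image)
qed simp

text \<open>Transitivity combines conjugation with the transitivity of commuting outside
  \<open>Z\<close>.\<close>

lemma fusion_equiv: "equiv (carrier G - Z) fusion"
proof (rule equivI)
  show "fusion \<subseteq> (carrier G - Z) \<times> (carrier G - Z)" by (auto simp: fusion_def)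
  show "refl_on (carrier G - Z) fusion"
    by (rule refl_onI) (auto simp: fusion_def intro!: bexI[of _ \<one>])
  show "sym fusion"
  proof (rule symI)
    fix x y assume "(x, y) \<in> fusion"
    then obtain g where g: "x \<in> carrier G - Z" "y \<in> carrier G - Z" "g \<in> carrier G"
      "commutes G (conjugate G g x) y" by (auto simp: fusion_def)
    then have "commutes G (conjugate G (inv g) (conjugate G g x)) (conjugate G (inv g) y)"
      by (subst commutes_conjugate) auto
    then have "commutes G (conjugate G (inv g) y) x" using g by (simp add: commutes_sym[of _ _ x])
    then show "(y, x) \<in> fusion" using g by (auto simp: fusion_def intro!: bexI[of _ "inv g"])
  qed
  show "trans fusion"
  proof (rule transI)
    fix x y w assume "(x, y) \<in> fusion" "(y, w) \<in> fusion"
    then obtain g h where g: "x \<in> carrier G - Z" "y \<in> carrier G - Z" "w \<in> carrier G - Z"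
      "g \<in> carrier G" "h \<in> carrier G"
      "commutes G (conjugate G g x) y" "commutes G (conjugate G h y) w" by (auto simp: fusion_def)
    then have "commutes G (conjugate G h (conjugate G g x)) (conjugate G h y)"
      by (subst commutes_conjugate) auto
    then have "commutes G (conjugate G (h \<otimes> g) x) (conjugate G h y)"
      using g by (simp only: conjugate_mult Diff_iff)
    moreover have "conjugate G h y \<notin> Z" "conjugate G h y \<in> carrier G"
      "conjugate G (h \<otimes> g) x \<in> carrier G" "w \<in> carrier G" using g(1-5) by simp_all
    ultimately have "commutes G (conjugate G (h \<otimes> g) x) w"
      using commutes_trans g(7) by blast
    then show "(x, w) \<in> fusion" unfolding fusion_def using g(1,3) m_closed[OF g(5,4)] by blast
  qed
qed

lemma class_image:
  assumes x: "x \<in> carrier G - Z"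
  shows "fusion `` {x} = (\<lambda>(g, y). conjugate G g y) ` (carrier G \<times> (cent x - Z))"
proof (intro equalityI subsetI)
  fix y assume "y \<in> fusion `` {x}"
  then obtain g where g: "y \<in> carrier G - Z" "g \<in> carrier G" "commutes G (conjugate G g x) y"
    by (auto simp: fusion_def)
  then have "commutes G (conjugate G (inv g) (conjugate G g x)) (conjugate G (inv g) y)"
    using x by (subst commutes_conjugate) auto
  then have "conjugate G (inv g) y \<in> cent x - Z" using g x by (auto simp: cent_def)
  moreover have "y = conjugate G g (conjugate G (inv g) y)" using g by simp
  ultimately show "y \<in> (\<lambda>(g, y). conjugate G g y) ` (carrier G \<times> (cent x - Z))"
    using g(2) by force
next
  fix y assume "y \<in> (\<lambda>(g, y). conjugate G g y) ` (carrier G \<times> (cent x - Z))"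
  then obtain g v where "y = conjugate G g v" "g \<in> carrier G" "v \<in> cent x - Z" by auto
  then have "y = conjugate G g v" "g \<in> carrier G" "v \<in> carrier G - Z" "commutes G x v" by (auto simp: cent_def)
  moreover from this have "commutes G (conjugate G g x) y" "y \<in> carrier G - Z"
    using x by simp_all
  ultimately show "y \<in> fusion `` {x}" unfolding fusion_def using x by blast
qed

text \<open>Pairs \<open>(g, y)\<close> with \<open>y\<close> in \<open>cent x - Z\<close> are
  counted by their value \<open>conjugate G g y\<close>; every fibre has the size of
  \<open>cent_stab x\<close>.\<close>

lemma card_class:
  assumes x: "x \<in> carrier G - Z"
  shows "card (fusion `` {x}) * card (cent_stab x) = card (carrier G) * (card (cent x) - card Z)"
proof -
  define P where "P = carrier G \<times> (cent x - Z)"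
  define f where "f = (\<lambda>(g, y). conjugate G g y)"
  have xc: "x \<in> carrier G" using x by simp
  have finP: "finite P" using fin by (simp add: P_def)
  have fibre: "card {p \<in> P. f p = w} = card (cent_stab x)" if w: "w \<in> f ` P" for w
  proof -
    obtain g y where g: "g \<in> carrier G" "y \<in> cent x - Z" "w = conjugate G g y"
      using w by (auto simp: P_def f_def)
    have y: "y \<in> carrier G" "y \<notin> Z" "commutes G x y" using g(2) by (auto simp: cent_def)
    \<comment> \<open>Since commuting is transitive outside \<open>Z\<close>, any \<open>y\<close>
      in \<open>cent x - Z\<close> can replace \<open>x\<close> as the conjugated element.\<close>
    have cent_stab: "h \<in> cent_stab x \<longleftrightarrow> h \<in> carrier G \<and> commutes G x (conjugate G h y)" for h
    proof -
      have "commutes G x (conjugate G h x) \<longleftrightarrow> commutes G x (conjugate G h y)" if h: "h \<in> carrier G"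
      proof -
        have c: "commutes G (conjugate G h x) (conjugate G h y)" using h xc y by simp
        have n: "conjugate G h x \<in> carrier G" "conjugate G h x \<notin> Z"
          "conjugate G h y \<in> carrier G" "conjugate G h y \<notin> Z" using h xc y x by simp_all
        show ?thesis
          using commutes_trans[OF xc n(1,2,3) _ c] commutes_trans[OF xc n(3,4,1) _ c[unfolded commutes_sym[of _ "conjugate G h x"]]]
          by blast
      qed
      then show ?thesis unfolding cent_stab_def by blast
    qed
    \<comment> \<open>Pairs over \<open>w\<close> differ from \<open>(g, y)\<close> by moving a
      factor \<open>h\<close> across; the second entry stays in \<open>cent x\<close> exactly for
      \<open>h\<close> in \<open>cent_stab x\<close>.\<close>
    have "{p \<in> P. f p = w} = (\<lambda>h. (g \<otimes> inv h, conjugate G h y)) ` cent_stab x"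
    proof (intro equalityI subsetI)
      fix p assume "p \<in> {p \<in> P. f p = w}"
      then obtain k v where p: "p = (k, v)" "k \<in> carrier G" "v \<in> cent x - Z" "conjugate G k v = w"
        by (auto simp: P_def f_def)
      have v: "v \<in> carrier G" "commutes G x v" using p by (auto simp: cent_def)
      have kc: "conjugate G (inv k) w = v" using p(2) v(1) by (simp flip: p(4))
      have veq: "conjugate G (inv k \<otimes> g) y = v" using p(2) kc g(1,3) y(1) by (simp add: conjugate_mult)
      have "inv k \<otimes> g \<in> cent_stab x" unfolding cent_stab veq using v p(2) g(1) by simp
      moreover have "k = g \<otimes> inv (inv k \<otimes> g)"
        using p(2) g(1) by (simp add: inv_mult_group flip: m_assoc)
      ultimately show "p \<in> (\<lambda>h. (g \<otimes> inv h, conjugate G h y)) ` cent_stab x"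
        unfolding p(1) by (intro image_eqI[of _ _ "inv k \<otimes> g"]) (simp_all only: veq)
    next
      fix p assume "p \<in> (\<lambda>h. (g \<otimes> inv h, conjugate G h y)) ` cent_stab x"
      then obtain h where h: "h \<in> carrier G" "commutes G x (conjugate G h y)"
        "p = (g \<otimes> inv h, conjugate G h y)" using cent_stab by blast
      moreover have "conjugate G (g \<otimes> inv h) (conjugate G h y) = w"
        using h(1) g(1,3) y(1) by (simp add: conjugate_mult)
      moreover have "conjugate G h y \<in> cent x - Z" using h(1,2) y(1,2) by (simp add: cent_def)
      ultimately show "p \<in> {p \<in> P. f p = w}"
        using g(1) by (simp add: P_def f_def)
    qed
    moreover have "inj_on (\<lambda>h. (g \<otimes> inv h, conjugate G h y)) (cent_stab x)"
      using g(1) by (auto simp: inj_on_def cent_stab_def)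
    ultimately show ?thesis by (simp add: card_image)
  qed
  have "card P = (\<Sum>w\<in>f ` P. card {p \<in> P. f p = w})"
    using sum.image_gen[OF finP, of "\<lambda>_. 1::nat" f] by simp
  also have "\<dots> = card (f ` P) * card (cent_stab x)" using fibre by simp
  also have "f ` P = fusion `` {x}" using class_image[OF x] by (simp add: f_def P_def)
  finally show ?thesis
    using Z_subset_cent[OF xc] by (simp add: P_def card_cartesian_product card_Diff_subset)
qed

lemma card_quotient_sum:
  "(\<Sum>c\<in>(carrier G - Z) // fusion. card c) = card (carrier G) - card Z"
proof -
  have "card (\<Union> ((carrier G - Z) // fusion)) = (\<Sum>c\<in>(carrier G - Z) // fusion. card c)"
  proof (rule card_Union_disjoint)
    show "pairwise disjnt ((carrier G - Z) // fusion)"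
      using quotient_disj[OF fusion_equiv] by (auto simp: pairwise_def disjnt_def)
    show "finite c" if "c \<in> (carrier G - Z) // fusion" for c
      using in_quotient_imp_subset[OF fusion_equiv that] fin finite_subset by blast
  qed
  then show ?thesis
    using subgroup.subset[OF Z] by (simp add: Union_quotient[OF fusion_equiv] card_Diff_subset)
qed

lemma Z_dvd:
  assumes "subgroup H G" "Z \<subseteq> H"
  shows "card Z dvd card H"
proof -
  have "subgroup Z (G\<lparr>carrier := H\<rparr>)" using assms Z by (simp add: subgroup_incl)
  then have "card (rcosets\<^bsub>G\<lparr>carrier := H\<rparr>\<^esub> Z) * card Z = Coset.order (G\<lparr>carrier := H\<rparr>)"
    by (rule group.lagrange[OF subgroup_imp_group[OF assms(1)]])
  then have "card H = card (rcosets\<^bsub>G\<lparr>carrier := H\<rparr>\<^esub> Z) * card Z" by (simp add: Coset.order_def)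
  then show ?thesis by simp
qed

text \<open>The class equation divided by the group order, with all orders taken modulo
  \<open>Z\<close>, is the hypothesis of \<open>polyhedral_orders\<close>; \<open>cent_stab\<close>
  supplies its strict inequality.\<close>

lemma orders:
  assumes x: "x \<in> carrier G - Z" and mx: "\<And>y. y \<in> carrier G - Z \<Longrightarrow> card (cent y) \<le> card (cent x)"
    and cent_stab: "cent_stab x \<noteq> carrier G"
  shows "(card (cent x) div card Z, card (carrier G) div card Z) \<in> {(2, 4), (3, 12), (4, 24), (5, 60)}"
proof -
  define z where "z = card Z"
  have z0: "0 < z" using subgroup.one_closed[OF Z] by (auto simp: z_def card_gt_0_iff)
  define \<eta> where "\<eta> = card (carrier G) div z"
  define Q where "Q = (carrier G - Z) // fusion"
  \<comment> \<open>The class of \<open>x\<close> is represented by \<open>x\<close> itself, so that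
    \<open>\<alpha> c0\<close> is the order of \<open>cent x\<close> modulo
    \<open>Z\<close>.\<close>
  define rep where "rep c = (if x \<in> c then x else SOME y. y \<in> c)" for c
  have rep: "rep c \<in> carrier G - Z" "c = fusion `` {rep c}" if c: "c \<in> Q" for c
  proof -
    obtain y where y: "y \<in> carrier G - Z" "c = fusion `` {y}" using c unfolding Q_def by (rule quotientE)
    have "y \<in> c" using equiv_class_self[OF fusion_equiv y(1)] y(2) by simp
    then have "rep c \<in> c" unfolding rep_def by (auto intro: someI)
    then have r: "(y, rep c) \<in> fusion" using y(2) by simp
    then show "rep c \<in> carrier G - Z" by (simp add: fusion_def)
    show "c = fusion `` {rep c}" using equiv_class_eq[OF fusion_equiv r] y(2) by simp
  qed
  define \<alpha> where "\<alpha> c = card (cent (rep c)) div z" for c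
  define e where "e c = card (cent_stab (rep c)) div card (cent (rep c))" for c
  have h: "card (carrier G) = z * \<eta>"
    using Z_dvd[OF subgroup_self] subgroup.subset[OF Z] by (simp add: \<eta>_def z_def)
  have a: "card (cent (rep c)) = z * \<alpha> c" if "c \<in> Q" for c
    using Z_dvd[OF cent_subgroup Z_subset_cent] rep(1)[OF that] by (simp add: \<alpha>_def z_def)
  have C0: "0 < card (cent y)" if "y \<in> carrier G" for y
    using that finite_sets(1)[of y] by (simp add: card_gt_0_iff) (auto simp: cent_def)
  have e: "(e c = 1 \<or> e c = 2) \<and> card (cent_stab (rep c)) = e c * card (cent (rep c))" if c: "c \<in> Q" for c
  proof -
    obtain k where k: "k = 1 \<or> k = 2" "card (cent_stab (rep c)) = k * card (cent (rep c))"
      using card_cent_stab[OF rep(1)[OF c]] by (metis mult_1)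
    have "card (cent (rep c)) \<noteq> 0" using C0[of "rep c"] rep(1)[OF c] by blast
    then have "e c = k" unfolding e_def k(2) by (rule nonzero_mult_div_cancel_right)
    then show ?thesis using k by simp
  qed
  have a2: "2 \<le> \<alpha> c" if c: "c \<in> Q" for c
  proof -
    have "rep c \<in> cent (rep c)" using rep(1)[OF c] by (simp add: cent_def)
    then have "Z \<subset> cent (rep c)" using Z_subset_cent[of "rep c"] rep(1)[OF c] by blast
    then have "z < card (cent (rep c))" unfolding z_def by (rule psubset_card_mono[rotated]) simp
    then show ?thesis using a[OF c] z0 by (cases "\<alpha> c" rule: nat.exhaust) (auto simp: neq0_conv)
  qed
  have NG: "card (cent_stab y) \<le> card (carrier G)" for y by (rule card_mono[OF fin]) (auto simp: cent_stab_def)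
  define c0 where "c0 = fusion `` {x}"
  have c0: "c0 \<in> Q" "rep c0 = x"
    using x equiv_class_self[OF fusion_equiv x] by (auto simp: c0_def Q_def rep_def quotientI)
  have "(\<alpha> c0, \<eta>) \<in> {(2, 4), (3, 12), (4, 24), (5, 60)}"
  proof (rule polyhedral_orders[of Q c0 \<alpha> e \<eta>])
    show "finite Q" unfolding Q_def
      by (rule finite_quotient) (use fin in \<open>auto simp: fusion_def\<close>)
    show "\<alpha> c \<le> \<alpha> c0" if "c \<in> Q" for c
      using mx[OF rep(1)[OF that]] c0(2) by (simp add: \<alpha>_def div_le_mono)
    show "e c * \<alpha> c \<le> \<eta>" if "c \<in> Q" for c
    proof -
      have "z * (e c * \<alpha> c) \<le> z * \<eta>" using NG[of "rep c"] e[OF that] a[OF that] h by (simp add: ac_simps)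
      then show ?thesis using z0 by simp
    qed
    have "card (cent_stab x) < card (carrier G)"
      using cent_stab by (intro psubset_card_mono[OF fin]) (auto simp: cent_stab_def)
    then have "z * (e c0 * \<alpha> c0) < z * \<eta>" using e[OF c0(1)] a[OF c0(1)] h c0(2) by (simp add: ac_simps)
    then show "e c0 * \<alpha> c0 < \<eta>" using z0 by simp
    then have \<eta>0: "0 < \<eta>" by simp
    \<comment> \<open>This is \<open>card_class\<close> solved for the size of the class.\<close>
    have w: "real (card c) = z * \<eta> * ((1 - 1 / real (\<alpha> c)) / real (e c))" if c: "c \<in> Q" for c
    proof -
      have "card c * (e c * (z * \<alpha> c)) = z * \<eta> * (z * \<alpha> c - z)"
        using card_class[OF rep(1)[OF c]] rep(2)[OF c] e[OF c] a[OF c] h by (simp add: z_def)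
      then have "z * (card c * e c * \<alpha> c) = z * (z * \<eta> * (\<alpha> c - 1))"
        by (simp add: algebra_simps diff_mult_distrib2)
      then have "card c * e c * \<alpha> c = z * \<eta> * (\<alpha> c - 1)" using z0 by simp
      then have "real (card c * e c * \<alpha> c) = real (z * \<eta> * (\<alpha> c - 1))" by (rule arg_cong)
      then have "real (card c) * e c * \<alpha> c = z * \<eta> * (real (\<alpha> c) - 1)"
        using a2[OF c] by (simp add: of_nat_diff)
      moreover have "real (\<alpha> c) > 0" "real (e c) > 0" using a2[OF c] e[OF c] by auto
      ultimately show ?thesis by (simp add: field_simps)
    qed
    have "real (card (carrier G) - card Z) = (\<Sum>c\<in>Q. real (card c))"
      using card_quotient_sum by (simp add: Q_def flip: of_nat_sum)
    also have "\<dots> = z * \<eta> * (\<Sum>c\<in>Q. (1 - 1 / real (\<alpha> c)) / real (e c))"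
      using w by (simp add: sum_distrib_left)
    finally have "z * \<eta> * (\<Sum>c\<in>Q. (1 - 1 / real (\<alpha> c)) / real (e c)) = real (z * \<eta> - z)"
      using h by (simp add: z_def)
    also have "\<dots> = z * \<eta> * (1 - 1 / real \<eta>)"
      using \<eta>0 by (simp add: field_simps of_nat_diff)
    finally show "(\<Sum>c\<in>Q. (1 - 1 / real (\<alpha> c)) / real (e c)) = 1 - 1 / real \<eta>"
      using z0 \<eta>0 by simp
  qed (use c0 a2 e in auto)
  then show ?thesis using c0(2) by (simp add: \<alpha>_def \<eta>_def z_def)
qed

text \<open>Needed to apply the class equation to the subgroup generated by a centralizer and one
  further element.\<close>

lemma restrict_subgroup:
  assumes K: "subgroup K G" "Z \<subseteq> K"
  shows "abelian_centralizer_group (G\<lparr>carrier := K\<rparr>) Z"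
    and "y \<in> K \<Longrightarrow> abelian_centralizer_group.cent (G\<lparr>carrier := K\<rparr>) y = cent y \<inter> K"
    and "y \<in> K \<Longrightarrow> abelian_centralizer_group.cent_stab (G\<lparr>carrier := K\<rparr>) y = cent_stab y \<inter> K"
proof -
  let ?K = "G\<lparr>carrier := K\<rparr>"
  have sub: "y \<in> carrier G" if "y \<in> K" for y using that subgroup.subset[OF K(1)] by blast
  have com: "commutes ?K = commutes G" by (simp add: commutes_def fun_eq_iff)
  have con: "conjugate ?K g y = conjugate G g y" if "g \<in> K" for g y
    using that m_inv_consistent[OF K(1)] by (simp add: conjugate_def)
  interpret K: group ?K by (rule subgroup_imp_group[OF K(1)])
  show *: "abelian_centralizer_group ?K Z"
  proof (intro abelian_centralizer_group.intro abelian_centralizer_group_axioms.intro K.group_axioms)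
    show "finite (carrier ?K)" using fin subgroup.subset[OF K(1)] by (auto intro: finite_subset)
    show "subgroup Z ?K" using K Z by (simp add: subgroup_incl)
    show "commutes ?K z x" if "z \<in> Z" "x \<in> carrier ?K" for z x
      using that central sub by (simp add: com)
    show "commutes ?K y w" if "x \<in> carrier ?K - Z" "y \<in> carrier ?K" "w \<in> carrier ?K"
      "commutes ?K x y" "commutes ?K x w" for x y w
      using that abelian[of x y w] sub by (simp add: com)
    show "\<exists>x'. \<forall>g\<in>carrier ?K. commutes ?K x (conjugate ?K g x) \<longrightarrow> conjugate ?K g x \<in> {x, x'}"
      if "x \<in> carrier ?K - Z" for x
    proof -
      have xG: "x \<in> carrier G - Z" using that sub by simp
      obtain x' where "\<forall>g\<in>carrier G. commutes G x (conjugate G g x) \<longrightarrow> conjugate G g x \<in> {x, x'}"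
        using two_conjugates xG by meson
      then show ?thesis using con sub by (intro exI[of _ x']) (simp add: com)
    qed
  qed
  show "abelian_centralizer_group.cent ?K y = cent y \<inter> K" if "y \<in> K"
    unfolding abelian_centralizer_group.cent_def[OF *] cent_def using sub by (auto simp: com)
  show "abelian_centralizer_group.cent_stab ?K y = cent_stab y \<inter> K" if "y \<in> K"
    unfolding abelian_centralizer_group.cent_stab_def[OF *] cent_stab_def using sub con by (auto simp: com)
qed

section \<open>Generation by two elements modulo \<open>Z\<close>\<close>

theorem two_generated:
  assumes cyclic: "\<And>x. x \<in> carrier G - Z \<Longrightarrow> \<exists>c\<in>carrier G. cent x \<subseteq> generate G (insert c Z)"
  shows "\<exists>a\<in>carrier G. \<exists>b\<in>carrier G. carrier G = generate G (insert a (insert b Z))"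
proof (cases "carrier G = Z")
  case True
  have "carrier G = generate G (insert \<one> (insert \<one> Z))"
    using True generate_incl[of "insert \<one> Z"] generate.incl[of _ "insert \<one> Z" G] by auto
  then show ?thesis by blast
next
  case False
  define S where "S = carrier G - Z"
  have S: "finite S" "S \<noteq> {}" using False fin subgroup.subset[OF Z] by (auto simp: S_def)
  then have "Max ((\<lambda>x. card (cent x)) ` S) \<in> (\<lambda>x. card (cent x)) ` S" by (intro Max_in) auto
  then obtain x where x: "x \<in> S" "card (cent x) = Max ((\<lambda>x. card (cent x)) ` S)" by auto
  have mx: "card (cent y) \<le> card (cent x)" if "y \<in> carrier G - Z" for y
    unfolding x(2) using S(1) that by (intro Max_ge) (auto simp: S_def)
  have xS: "x \<in> carrier G - Z" and xc: "x \<in> carrier G" using x(1) by (auto simp: S_def)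
  obtain c where c: "c \<in> carrier G" "cent x \<subseteq> generate G (insert c Z)" using cyclic[OF xS] by blast
  \<comment> \<open>One generator, \<open>c\<close>, accounts for \<open>cent x\<close>; it remains
    to find a \<open>g\<close> that lies with \<open>cent x\<close> in no proper subgroup.\<close>
  have gen: "\<exists>a\<in>carrier G. \<exists>b\<in>carrier G. carrier G = generate G (insert a (insert b Z))"
    if g: "g \<in> carrier G" and H: "\<And>H. subgroup H G \<Longrightarrow> g \<in> H \<Longrightarrow> cent x \<subseteq> H \<Longrightarrow> carrier G \<subseteq> H" for g
  proof -
    let ?H = "generate G (insert g (insert c Z))"
    have "insert g (insert c Z) \<subseteq> carrier G" using g c(1) subgroup.subset[OF Z] by blast
    then have "subgroup ?H G" by (rule generate_is_subgroup)
    moreover have "g \<in> ?H" by (simp add: generate.incl)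
    moreover have "cent x \<subseteq> ?H" using c(2) mono_generate[of "insert c Z" "insert g (insert c Z)"] by blast
    ultimately have "carrier G = ?H" using H subgroup.subset by blast
    then show ?thesis using g c(1) by blast
  qed
  show ?thesis
  proof (cases "cent_stab x = carrier G")
    case True
    \<comment> \<open>Here \<open>cent x\<close> has index at most two, so a representative of the
      other coset, or the identity, can serve as \<open>g\<close>.\<close>
    show ?thesis
    proof (rule cent_stab_cases[OF xS])
      assume "cent_stab x = cent x"
      then show ?thesis using True by (intro gen[OF one_closed]) simp
    next
      fix g assume g: "g \<in> cent_stab x" "cent_stab x = cent x \<union> (\<lambda>y. g \<otimes> y) ` cent x"
      show ?thesis
      proof (rule gen[of g])
        show "g \<in> carrier G" using g(1) True by simp
        show "carrier G \<subseteq> H" if "subgroup H G" "g \<in> H" "cent x \<subseteq> H" for H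
          using that g(2) True subgroup.m_closed[OF that(1,2)] by auto
      qed
    qed
  next
    case False
    then obtain g where g: "g \<in> carrier G" "g \<notin> cent_stab x" by (auto simp: cent_stab_def)
    define K where "K = generate G (insert g (cent x))"
    have K: "subgroup K G" "g \<in> K" "cent x \<subseteq> K"
      using g(1) subgroup.subset[OF cent_subgroup[OF xc]]
      by (auto simp: K_def intro: generate_is_subgroup generate.incl)
    have ZK: "Z \<subseteq> K" and xK: "x \<in> K" using Z_subset_cent[OF xc] K(3) xc by (auto simp: cent_def)
    note Kc = subgroup.subset[OF K(1)]
    interpret K: abelian_centralizer_group "G\<lparr>carrier := K\<rparr>" Z
      by (rule restrict_subgroup(1)[OF K(1) ZK])
    have KC: "K.cent y = cent y \<inter> K" and KN: "K.cent_stab y = cent_stab y \<inter> K" if "y \<in> K" for y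
      using restrict_subgroup(2,3)[OF K(1) ZK that] .
    have KCx: "K.cent x = cent x" using KC[OF xK] K(3) by blast
    \<comment> \<open>In \<open>K\<close> the centralizer of \<open>x\<close> is unchanged and still
      largest, and \<open>g\<close> does not stabilize it, so \<open>orders\<close> applies to
      \<open>K\<close> as well.\<close>
    have "(card (K.cent x) div card Z, card (carrier (G\<lparr>carrier := K\<rparr>)) div card Z) \<in> {(2, 4), (3, 12), (4, 24), (5, 60)}"
    proof (rule K.orders)
      show "x \<in> carrier (G\<lparr>carrier := K\<rparr>) - Z" using xK xS by simp
      show "card (K.cent y) \<le> card (K.cent x)" if "y \<in> carrier (G\<lparr>carrier := K\<rparr>) - Z" for y
      proof -
        have "y \<in> K" "y \<in> carrier G - Z" using that Kc by auto
        then have "card (K.cent y) \<le> card (cent y)" using KC by (intro card_mono) auto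
        then show ?thesis using mx[of y] \<open>y \<in> carrier G - Z\<close> KCx by simp
      qed
      show "K.cent_stab x \<noteq> carrier (G\<lparr>carrier := K\<rparr>)" using KN[OF xK] g K(2) by auto
    qed
    \<comment> \<open>The four possible pairs have distinct first entries, and the first entry is
      the same for \<open>K\<close> and the whole group.\<close>
    then have "card K div card Z = card (carrier G) div card Z"
      using orders[OF xS mx False] KCx by auto
    then have "card K = card (carrier G)"
      using Z_dvd[OF K(1) ZK] Z_dvd[OF subgroup_self subgroup.subset[OF Z]] by (metis dvd_div_mult_self)
    then have "K = carrier G" using Kc fin by (simp add: card_subset_eq)
    then show ?thesis
      using generate_subgroup_incl[of "insert g (cent x)"] by (intro gen[OF g(1)]) (simp add: K_def)
  qed
qed

end

section \<open>Finite multiplicative subgroups of fields\<close>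

context comm_group
begin

text \<open>Raising the product to a multiple of \<open>ord y\<close> removes \<open>y\<close>, so
  \<open>ord x\<close> divides \<open>ord (x \<otimes> y) * ord y\<close>, and coprimality removes
  the second factor.\<close>

lemma ord_mult_coprime:
  assumes x: "x \<in> carrier G" and y: "y \<in> carrier G" and cop: "coprime (ord x) (ord y)"
  shows "ord (x \<otimes> y) = ord x * ord y"
proof (rule dvd_antisym)
  have dvd: "ord a dvd ord (a \<otimes> b)"
    if ab: "a \<in> carrier G" "b \<in> carrier G" "coprime (ord a) (ord b)" for a b
  proof -
    let ?n = "ord (a \<otimes> b)"
    have "\<one> = (a \<otimes> b) [^] (?n * ord b)"
      using ab by (simp add: pow_ord_eq_1 flip: nat_pow_pow)
    also have "\<dots> = a [^] (?n * ord b) \<otimes> b [^] (ord b * ?n)"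
      using ab by (simp add: pow_mult_distrib m_comm mult.commute)
    also have "b [^] (ord b * ?n) = \<one>"
      using ab by (simp add: pow_ord_eq_1 flip: nat_pow_pow)
    finally have "a [^] (?n * ord b) = \<one>" using ab by simp
    then have "ord a dvd ?n * ord b" using pow_eq_id[OF ab(1)] by blast
    then show ?thesis using ab(3) by (simp add: coprime_dvd_mult_left_iff)
  qed
  have "ord x dvd ord (x \<otimes> y)" "ord y dvd ord (x \<otimes> y)"
    using dvd[OF x y cop] dvd[OF y x] cop x y by (simp_all add: m_comm coprime_commute)
  then show "ord x * ord y dvd ord (x \<otimes> y)" using cop by (simp add: divides_mult)
  have "(x \<otimes> y) [^] (ord x * ord y) = x [^] (ord x * ord y) \<otimes> y [^] (ord y * ord x)"
    using x y by (simp add: pow_mult_distrib m_comm mult.commute)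
  also have "\<dots> = \<one>" using x y by (simp add: pow_ord_eq_1 flip: nat_pow_pow)
  finally show "ord (x \<otimes> y) dvd ord x * ord y" using x y pow_eq_id by simp
qed

text \<open>Take \<open>g\<close> of largest order. If a prime \<open>q\<close> had higher
  multiplicity in \<open>ord x\<close>, the \<open>q\<close>-part of \<open>x\<close> times the
  \<open>q\<close>-free part of \<open>g\<close> would have larger order.\<close>

lemma ex_ord_eq_exponent:
  assumes fin: "finite (carrier G)"
  shows "\<exists>g\<in>carrier G. \<forall>x\<in>carrier G. ord x dvd ord g"
proof -
  have "Max (ord ` carrier G) \<in> ord ` carrier G" using fin by (intro Max_in) auto
  then obtain g where g: "g \<in> carrier G" "ord g = Max (ord ` carrier G)" by auto
  have mx: "ord x \<le> ord g" if "x \<in> carrier G" for x using fin that unfolding g(2) by simp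
  have pos: "0 < ord x" if "x \<in> carrier G" for x using ord_ge_1[OF fin that] by simp
  have "ord x dvd ord g" if x: "x \<in> carrier G" for x
  proof (rule multiplicity_le_imp_dvd)
    show "ord x \<noteq> 0" using pos[OF x] by simp
    fix q :: nat assume q: "Factorial_Ring.prime q"
    define i where "i = multiplicity q (ord x)"
    define j where "j = multiplicity q (ord g)"
    obtain m where m: "ord x = q ^ i * m" using multiplicity_dvd[of q "ord x"] by (auto simp: i_def elim: dvdE)
    have "\<not> q dvd ord g div q ^ j"
      using multiplicity_decompose[of "ord g" q] pos[OF g(1)] prime_gt_1_nat[OF q] by (auto simp: j_def)
    then obtain n where n: "ord g = q ^ j * n" "\<not> q dvd n"
      using multiplicity_dvd[of q "ord g"] by (metis dvd_mult_div_cancel j_def)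
    have m0: "m \<noteq> 0" using m pos[OF x] by auto
    have n0: "n \<noteq> 0" using n pos[OF g(1)] by auto
    have q0: "q ^ k \<noteq> 0" for k using q by auto
    have ox: "ord (x [^] m) = q ^ i" using ord_pow_gen[OF x, of m] m m0 by simp
    have og: "ord (g [^] (q ^ j)) = n" using ord_pow_gen[OF g(1), of "q ^ j"] n prime_gt_0_nat[OF q] by simp
    have "coprime (q ^ i) n" using q n(2) by (simp add: prime_imp_coprime)
    then have "ord (x [^] m \<otimes> g [^] (q ^ j)) = q ^ i * n"
      using ord_mult_coprime[of "x [^] m" "g [^] (q ^ j)"] x g(1) ox og by simp
    moreover have "x [^] m \<otimes> g [^] (q ^ j) \<in> carrier G" using x g(1) by simp
    ultimately have "q ^ i * n \<le> q ^ j * n" using mx n(1) by metis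
    then have "q ^ i \<le> q ^ j" using n0 by simp
    then show "multiplicity q (ord x) \<le> multiplicity q (ord g)"
      using q by (simp add: i_def j_def prime_gt_Suc_0_nat)
  qed
  then show ?thesis using g(1) by blast
qed

end

text \<open>If the order \<open>n\<close> of \<open>g\<close> is the exponent, all of
  \<open>S\<close> are roots of \<open>X^n - 1\<close>; hence \<open>S\<close> has at most
  \<open>n\<close> elements and \<open>g\<close> generates it.\<close>

lemma finite_field_subgroup_cyclic:
  fixes S :: "'f::field set"
  assumes fin: "finite S" and one: "1 \<in> S" and nz: "0 \<notin> S"
    and mult: "\<And>x y. x \<in> S \<Longrightarrow> y \<in> S \<Longrightarrow> x * y \<in> S"
  obtains g where "g \<in> S" "\<And>x. x \<in> S \<Longrightarrow> \<exists>n. x = g ^ n"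
proof -
  define M where "M = \<lparr>carrier = S, monoid.mult = ((*) :: 'f \<Rightarrow> _), one = 1\<rparr>"
  interpret M: comm_group M
  proof (rule comm_groupI)
    show "\<exists>y\<in>carrier M. y \<otimes>\<^bsub>M\<^esub> x = \<one>\<^bsub>M\<^esub>" if "x \<in> carrier M" for x
    proof -
      have x: "x \<in> S" "x \<noteq> 0" using that nz by (auto simp: M_def)
      \<comment> \<open>Finiteness supplies inverses: multiplication by \<open>x\<close> is
        injective on \<open>S\<close>, hence onto.\<close>
      have "(\<lambda>y. y * x) ` S = S"
        using x mult by (intro card_subset_eq fin) (auto simp: card_image inj_on_def)
      then obtain y where "y \<in> S" "y * x = 1" using one by (metis (no_types, lifting) imageE)
      then show ?thesis by (auto simp: M_def)
    qed
  qed (auto simp: M_def one mult mult.assoc mult.commute)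
  have pow: "x [^]\<^bsub>M\<^esub> n = x ^ n" for x :: 'f and n :: nat
    by (induction n) (simp_all add: M_def mult.commute)
  have finM: "finite (carrier M)" using fin by (simp add: M_def)
  obtain g where g: "g \<in> carrier M" "\<And>x. x \<in> carrier M \<Longrightarrow> M.ord x dvd M.ord g"
    using M.ex_ord_eq_exponent[OF finM] by blast
  define n where "n = M.ord g"
  have n0: "0 < n" using M.ord_ge_1[OF finM g(1)] by (simp add: n_def)
  define p :: "'f poly" where "p = Polynomial.monom 1 n + [:-1:]"
  have "degree p = n" unfolding p_def using n0 by (subst degree_add_eq_left) (simp_all add: degree_monom_eq)
  moreover from this have "p \<noteq> 0" using n0 by auto
  ultimately have roots: "finite {x. poly p x = 0}" "card {x. poly p x = 0} \<le> n"
    using card_poly_roots_bound[of p] poly_roots_finite[of p] by simp_all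
  have "S \<subseteq> {x. poly p x = 0}"
  proof
    fix x assume "x \<in> S"
    then have "x \<in> carrier M" by (simp add: M_def)
    then have "x ^ n = 1" using g(2) M.pow_eq_id[of x n] by (simp add: n_def pow) (simp add: M_def)
    then show "x \<in> {x. poly p x = 0}" by (simp add: p_def poly_monom)
  qed
  then have le: "card S \<le> n" using roots by (meson card_mono le_trans)
  have "card (generate M {g}) = n" using M.generate_pow_card[OF g(1)] by (simp add: n_def)
  moreover have "generate M {g} \<subseteq> S" using M.generate_incl[of "{g}"] g(1) by (simp add: M_def)
  ultimately have "generate M {g} = S" using le fin by (metis card_seteq)
  then have "\<exists>n. x = g ^ n" if "x \<in> S" for x
    using M.generate_pow_nat[OF g(1)] n0 that by (auto simp: pow n_def)
  then show ?thesis using that g(1) by (simp add: M_def)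
qed

section \<open>Subgroups of SL(2, p)\<close>

definition mat2 :: "'k \<Rightarrow> 'k \<Rightarrow> 'k \<Rightarrow> 'k \<Rightarrow> 'k::field ^ 2 ^ 2" where
  "mat2 a b c d = vector [vector [a, b], vector [c, d]]"

lemma mat2_nth [simp]:
  "mat2 a b c d $ 1 $ 1 = a" "mat2 a b c d $ 1 $ 2 = b"
  "mat2 a b c d $ 2 $ 1 = c" "mat2 a b c d $ 2 $ 2 = d"
  by (simp_all add: mat2_def)

lemma matrix2_eq_iff:
  "(A :: 'k::field ^ 2 ^ 2) = B \<longleftrightarrow>
    A $ 1 $ 1 = B $ 1 $ 1 \<and> A $ 1 $ 2 = B $ 1 $ 2 \<and> A $ 2 $ 1 = B $ 2 $ 1 \<and> A $ 2 $ 2 = B $ 2 $ 2"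
  by (simp add: vec_eq_iff forall_2 conj_assoc)

lemma mat2_eq_iff [simp]:
  "mat2 a b c d = mat2 a' b' c' d' \<longleftrightarrow> a = a' \<and> b = b' \<and> c = c' \<and> d = d'"
  by (simp add: matrix2_eq_iff)

lemma mat2_exhaust: obtains a b c d where "A = mat2 a b c d"
  by (rule that[of "A $ 1 $ 1" "A $ 1 $ 2" "A $ 2 $ 1" "A $ 2 $ 2"]) (simp add: matrix2_eq_iff)

lemma mat2_mult:
  "mat2 a b c d ** mat2 a' b' c' d' = mat2 (a*a' + b*c') (a*b' + b*d') (c*a' + d*c') (c*b' + d*d')"
  by (simp add: matrix2_eq_iff matrix_matrix_mult_def sum_2)

lemma det_mat2 [simp]: "det (mat2 a b c d) = a * d - b * c"
  by (simp add: det_2)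

lemma mat_1_eq_mat2: "mat 1 = mat2 1 0 0 1"
  by (simp add: matrix2_eq_iff mat_def)

text \<open>The equations are the vanishing 2-by-2 minors of two triples; one divides by a nonzero
  coordinate of the first.\<close>

lemma parallel:
  fixes b :: "'k::field"
  assumes "b \<noteq> 0 \<or> c \<noteq> 0 \<or> s \<noteq> 0"
    and "b * g = c * f" "b * t = f * s" "c * t = g * s"
  obtains \<beta> where "f = \<beta> * b" "g = \<beta> * c" "t = \<beta> * s"
proof -
  consider "b \<noteq> 0" | "c \<noteq> 0" | "s \<noteq> 0" using assms(1) by blast
  then show ?thesis
  proof cases
    case 1
    then show ?thesis using assms that[of "f / b"] by (simp add: field_simps)
  next
    case 2
    then show ?thesis using assms that[of "g / c"] by (simp add: field_simps)
  next
    case 3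
    then show ?thesis using assms that[of "t / s"] by (simp add: field_simps)
  qed
qed

text \<open>Modulo scalars a matrix is the triple \<open>(b, c, d - a)\<close>, and commuting means
  that the triples are parallel.\<close>

lemma mat2_commute_iff:
  "mat2 a b c d ** mat2 e f g h = mat2 e f g h ** mat2 a b c d \<longleftrightarrow>
    b * g = c * f \<and> b * (h - e) = f * (d - a) \<and> c * (h - e) = g * (d - a)"
  unfolding mat2_mult mat2_eq_iff by (auto simp: algebra_simps)

lemma mat2_commute_obtain:
  assumes "b \<noteq> 0 \<or> c \<noteq> 0 \<or> a \<noteq> d"
    and "mat2 a b c d ** mat2 e f g h = mat2 e f g h ** mat2 a b c d"
  obtains \<beta> where "f = \<beta> * b" "g = \<beta> * c" "h - e = \<beta> * (d - a)"
proof (rule parallel[of b c "d - a" g f "h - e"])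
  show "b \<noteq> 0 \<or> c \<noteq> 0 \<or> d - a \<noteq> 0" using assms(1) by auto
qed (use assms(2) that in \<open>auto simp: mat2_commute_iff\<close>)

text \<open>Both triples are multiples of the nonzero triple of the first matrix.\<close>

lemma mat2_commute_trans:
  assumes "b \<noteq> 0 \<or> c \<noteq> 0 \<or> a \<noteq> d"
    and "mat2 a b c d ** mat2 e f g h = mat2 e f g h ** mat2 a b c d"
    and "mat2 a b c d ** mat2 e' f' g' h' = mat2 e' f' g' h' ** mat2 a b c d"
  shows "mat2 e f g h ** mat2 e' f' g' h' = mat2 e' f' g' h' ** mat2 e f g h"
proof -
  obtain \<beta> where b: "f = \<beta> * b" "g = \<beta> * c" "h - e = \<beta> * (d - a)"
    using mat2_commute_obtain[OF assms(1,2)] .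
  obtain \<beta>' where b': "f' = \<beta>' * b" "g' = \<beta>' * c" "h' - e' = \<beta>' * (d - a)"
    using mat2_commute_obtain[OF assms(1,3)] .
  show ?thesis unfolding mat2_commute_iff b b' by (simp add: algebra_simps)
qed

text \<open>Equal trace and determinant give equal discriminants, nonzero by \<open>t\<close>, so
  the proportionality factor is 1 or -1. The second matrix listed is the inverse of the
  first.\<close>

lemma mat2_commuting_conjugates:
  assumes ns: "b \<noteq> 0 \<or> c \<noteq> 0 \<or> a \<noteq> d" and t: "(a + d)\<^sup>2 \<noteq> (4 :: 'k::field)"
    and det: "a * d - b * c = 1" "e * h - f * g = 1" and tr: "e + h = a + d"
    and com: "mat2 a b c d ** mat2 e f g h = mat2 e f g h ** mat2 a b c d"
  shows "mat2 e f g h \<in> {mat2 a b c d, mat2 d (-b) (-c) a}"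
proof -
  obtain \<beta> where \<beta>: "f = \<beta> * b" "g = \<beta> * c" "h - e = \<beta> * (d - a)"
    using mat2_commute_obtain[OF ns com] .
  have "(h - e)\<^sup>2 + 4 * f * g = (e + h)\<^sup>2 - 4 * (e * h - f * g)"
    by (simp add: power2_eq_square algebra_simps)
  also have "\<dots> = (a + d)\<^sup>2 - 4 * (a * d - b * c)" using det tr by simp
  also have "\<dots> = (d - a)\<^sup>2 + 4 * b * c" by (simp add: power2_eq_square algebra_simps)
  finally have "\<beta>\<^sup>2 * ((d - a)\<^sup>2 + 4 * b * c) = (d - a)\<^sup>2 + 4 * b * c"
    unfolding \<beta> by (simp add: power2_eq_square algebra_simps)
  moreover have "(d - a)\<^sup>2 + 4 * b * c = (a + d)\<^sup>2 - 4 * (a * d - b * c)"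
    by (simp add: power2_eq_square algebra_simps)
  then have "(d - a)\<^sup>2 + 4 * b * c \<noteq> 0" using t det(1) by simp
  ultimately have "\<beta>\<^sup>2 = 1" by simp
  then have "\<beta> = 1 \<or> \<beta> = -1" by (simp add: power2_eq_1_iff)
  then show ?thesis
  proof
    assume b: "\<beta> = 1"
    have h: "h = e + (d - a)" using \<beta>(3) b by (simp add: algebra_simps)
    have "e * h = a * d" using det \<beta> b by (simp add: algebra_simps)
    then have "(e - a) * (e + d) = 0" unfolding h by (simp add: algebra_simps)
    then have "e = a \<or> e = - d" by (auto simp: eq_neg_iff_add_eq_0)
    then show ?thesis
    proof
      \<comment> \<open>This root agrees with a listed matrix: in characteristic 2 signs vanish and
        the inverse results, while for trace 0 one has \<open>- d = a\<close>.\<close>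
      assume e: "e = - d"
      have "2 * (a + d) = 0" using tr unfolding h e by (simp add: algebra_simps)
      then consider "(2::'k) = 0" | "a + d = 0" unfolding mult_eq_0_iff by blast
      then show ?thesis
      proof cases
        case 1
        then have n: "- x = x" for x :: 'k
          by (metis add_eq_0_iff mult_2 mult_zero_left)
        show ?thesis using e h \<beta> b n[of d] n[of a] n[of b] n[of c] by simp
      next
        case 2
        then have "a = - d" by (simp add: eq_neg_iff_add_eq_0)
        then have "e = a" "h = d" using e h by simp_all
        then show ?thesis using \<beta> b by simp
      qed
    qed (use h \<beta> b in simp)
  next
    assume b: "\<beta> = -1"
    have h: "h = e + (a - d)" using \<beta>(3) b by (simp add: algebra_simps)
    have "e * h = a * d" using det \<beta> b by (simp add: algebra_simps)
    then have "(e - d) * (e + a) = 0" unfolding h by (simp add: algebra_simps)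
    then have "e = d \<or> e = - a" by (auto simp: eq_neg_iff_add_eq_0)
    then show ?thesis
    proof
      assume e: "e = - a"
      have "2 * (a + d) = 0" using tr unfolding h e by (simp add: algebra_simps)
      then consider "(2::'k) = 0" | "a + d = 0" unfolding mult_eq_0_iff by blast
      then show ?thesis
      proof cases
        case 1
        then have n: "- x = x" for x :: 'k
          by (metis add_eq_0_iff mult_2 mult_zero_left)
        show ?thesis using e h \<beta> b n[of d] n[of a] n[of b] n[of c] by simp
      next
        case 2
        then have "d = - a" by (simp add: eq_neg_iff_add_eq_0 add.commute)
        then have "e = d" "h = a" using e h by simp_all
        then show ?thesis using \<beta> b by simp
      qed
    qed (use h \<beta> b in simp)
  qed
qed

section \<open>The group SL(2) and its centre\<close>

abbreviation SL2 :: "('k::field ^ 2 ^ 2) monoid" where "SL2 \<equiv> special_linear"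

lemma SL2_mult [simp]: "A \<otimes>\<^bsub>SL2\<^esub> B = A ** B"
  and SL2_one [simp]: "\<one>\<^bsub>SL2\<^esub> = mat2 1 0 0 1"
  and carrier_SL2: "carrier SL2 = {A. det A = 1}"
  by (simp_all add: special_linear_def mat_1_eq_mat2)

lemma mat2_in_SL2 [simp]: "mat2 a b c d \<in> carrier SL2 \<longleftrightarrow> a * d - b * c = 1"
  by (simp add: carrier_SL2)

lemma inv_SL2:
  assumes "a * d - b * c = 1"
  shows "inv\<^bsub>SL2\<^esub> (mat2 a b c d) = mat2 d (- b) (- c) a"
  by (rule group.inv_equality[OF group_special_linear])
    (use assms in \<open>auto simp: mat2_mult algebra_simps\<close>)

lemma centre_SL2:
  "mat2 a b c d \<in> centre SL2 \<longleftrightarrow> b = 0 \<and> c = 0 \<and> a = d \<and> a * a = (1::'k::field)"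
proof
  assume z: "mat2 a b c d \<in> centre (SL2 :: ('k ^ 2 ^ 2) monoid)"
  \<comment> \<open>Commuting with one upper and one lower unitriangular matrix already forces a
    scalar matrix.\<close>
  have "mat2 a b c d ** mat2 1 1 0 1 = mat2 1 1 0 1 ** mat2 a b c d"
    "mat2 a b c d ** mat2 1 0 1 1 = mat2 1 0 1 1 ** mat2 a b c d"
    using z unfolding centre_def by (auto simp del: mat2_eq_iff)
  then have "b = 0 \<and> c = 0 \<and> a = d" by (auto simp: mat2_mult)
  moreover have "a * d - b * c = 1" using z by (simp add: centre_def)
  ultimately show "b = 0 \<and> c = 0 \<and> a = d \<and> a * a = 1" by simp
next
  assume "b = 0 \<and> c = 0 \<and> a = d \<and> a * a = 1"
  moreover have "mat2 a 0 0 a ** A = A ** mat2 a 0 0 a" for A :: "'k ^ 2 ^ 2"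
    by (rule mat2_exhaust[of A]) (simp add: mat2_mult mult.commute)
  ultimately show "mat2 a b c d \<in> centre SL2" by (auto simp: centre_def)
qed

lemma trace_conjugate_SL2:
  assumes "A \<in> carrier SL2" "B \<in> carrier SL2"
  shows "trace (conjugate SL2 A B) = trace (B :: 'k::field ^ 2 ^ 2)"
proof -
  interpret group "SL2 :: ('k ^ 2 ^ 2) monoid" by (rule group_special_linear)
  have "trace (conjugate SL2 A B) = trace (inv\<^bsub>SL2\<^esub> A ** (A ** B))"
    by (simp add: conjugate_def trace_mul_sym[of "A ** B"])
  also have "inv\<^bsub>SL2\<^esub> A ** (A ** B) = B"
    using assms l_inv[OF assms(1)] l_one[OF assms(2)] by (simp add: matrix_mul_assoc)
  finally show ?thesis .
qed

lemma trace_mat2 [simp]: "trace (mat2 a b c d) = a + d"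
  by (simp add: trace_def sum_2)

section \<open>Subgroups whose noncentral elements have distinct eigenvalues\<close>

lemma (in group) nat_pow_mem_subgroup:
  assumes "subgroup H G" "x \<in> H"
  shows "x [^] (n::nat) \<in> H"
  by (induction n) (use assms in \<open>auto intro: subgroup.one_closed subgroup.m_closed\<close>)

text \<open>A common eigenvector of the matrices in \<open>A\<close> exists over the algebraic closure; taking its eigenvalue
  embeds \<open>A\<close> into the multiplicative group.\<close>
lemma centralizer_cyclic:
  fixes a b c d :: "'k::{field, finite}"
  assumes A: "subgroup A SL2" and x: "a * d - b * c = 1"
    and ns: "b \<noteq> 0 \<or> c \<noteq> 0 \<or> a \<noteq> d" and t: "(a + d)\<^sup>2 \<noteq> 4"
    and com: "\<And>y. y \<in> A \<Longrightarrow> mat2 a b c d ** y = y ** mat2 a b c d"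
  obtains g where "g \<in> A" "A \<subseteq> generate SL2 {g}"
proof -
  interpret SL: group "SL2 :: ('k ^ 2 ^ 2) monoid" by (rule group_special_linear)
  \<comment> \<open>\<open>M \<alpha> \<beta>\<close> is \<open>\<alpha> + \<beta> x\<close> for the
    given nonscalar matrix \<open>x\<close>; the matrices commuting with \<open>x\<close> all have
    this form. The product rule below is Cayley-Hamilton, \<open>x^2 = \<tau> x - 1\<close>.\<close>
  define M where "M \<alpha> \<beta> = mat2 (\<alpha> + \<beta> * a) (\<beta> * b) (\<beta> * c) (\<alpha> + \<beta> * d)" for \<alpha> \<beta>
  define \<tau> where "\<tau> = a + d"
  have bc: "b * c = a * d - 1" using x by (simp add: algebra_simps)
  have M_inj: "M \<alpha> \<beta> = M \<alpha>' \<beta>' \<longleftrightarrow> \<alpha> = \<alpha>' \<and> \<beta> = \<beta>'" for \<alpha> \<beta> \<alpha>' \<beta>'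
  proof
    assume e: "M \<alpha> \<beta> = M \<alpha>' \<beta>'"
    have "(\<beta> - \<beta>') * (a - d) = ((\<alpha> + \<beta> * a) - (\<alpha> + \<beta> * d)) - ((\<alpha>' + \<beta>' * a) - (\<alpha>' + \<beta>' * d))"
      by (simp add: algebra_simps)
    also have "\<dots> = 0" using e by (simp only: M_def mat2_eq_iff diff_self)
    finally have "\<beta> = \<beta>'" using e ns by (auto simp: M_def)
    then show "\<alpha> = \<alpha>' \<and> \<beta> = \<beta>'" using e by (simp add: M_def)
  qed simp
  have M_mult: "M \<alpha> \<beta> ** M \<alpha>' \<beta>' = M (\<alpha> * \<alpha>' - \<beta> * \<beta>') (\<alpha> * \<beta>' + \<alpha>' * \<beta> + \<beta> * \<beta>' * \<tau>)" for \<alpha> \<beta> \<alpha>' \<beta>'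
  proof -
    have "\<beta> * b * (\<beta>' * c) = \<beta> * \<beta>' * (a * d - 1)" "\<beta> * c * (\<beta>' * b) = \<beta> * \<beta>' * (a * d - 1)"
      by (simp_all add: ac_simps flip: bc)
    then show ?thesis by (simp add: M_def mat2_mult \<tau>_def algebra_simps)
  qed
  have M_det: "det (M \<alpha> \<beta>) = \<alpha> * \<alpha> + \<alpha> * \<beta> * \<tau> + \<beta> * \<beta>" for \<alpha> \<beta>
  proof -
    have "\<beta> * b * (\<beta> * c) = \<beta> * \<beta> * (a * d - 1)" by (simp add: ac_simps flip: bc)
    then show ?thesis by (simp add: M_def \<tau>_def algebra_simps)
  qed
  have ex: "\<exists>p. y = M (fst p) (snd p)" if y: "y \<in> A" for y
  proof (rule mat2_exhaust[of y])
    fix e f g h assume eq: "y = mat2 e f g h"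
    obtain \<beta> where \<beta>: "f = \<beta> * b" "g = \<beta> * c" "h - e = \<beta> * (d - a)"
      using mat2_commute_obtain[OF ns com[OF y, unfolded eq]] .
    have "h = e + \<beta> * (d - a)" using \<beta>(3) by (simp add: algebra_simps)
    then have "y = M (e - \<beta> * a) \<beta>" unfolding eq M_def \<beta>(1,2) by (simp add: algebra_simps)
    then show ?thesis by (intro exI[of _ "(e - \<beta> * a, \<beta>)"]) simp
  qed
  then obtain p where p: "\<And>y. y \<in> A \<Longrightarrow> y = M (fst (p y)) (snd (p y))" by metis
  \<comment> \<open>\<open>l\<close> is an eigenvalue of the given matrix; the other one is
    \<open>to_ac \<tau> - l\<close>.\<close>
  obtain l :: "'k alg_closure" where "poly [:1, - to_ac \<tau>, 1:] l = 0"
    using alg_closed_imp_poly_has_root[of "[:1, - to_ac \<tau>, 1:]"] by auto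
  then have l: "l * l = to_ac \<tau> * l - 1" by (simp add: algebra_simps add_eq_0_iff)
  define \<phi> where "\<phi> y = to_ac (fst (p y)) + to_ac (snd (p y)) * l" for y
  \<comment> \<open>the conjugate of \<open>\<phi>\<close>: the product of both is the determinant\<close>
  define \<phi>' where "\<phi>' y = to_ac (fst (p y)) + to_ac (snd (p y)) * (to_ac \<tau> - l)" for y
  have \<phi>M: "\<phi> y = to_ac \<alpha> + to_ac \<beta> * l" if "y \<in> A" "y = M \<alpha> \<beta>" for y \<alpha> \<beta>
    using p[OF that(1)] that(2) M_inj by (metis \<phi>_def)
  have norm: "\<phi> y * \<phi>' y = 1" if y: "y \<in> A" for y
  proof -
    have "det y = 1" using subgroup.subset[OF A] y by (auto simp: carrier_SL2)
    then have n: "fst (p y) * fst (p y) + fst (p y) * snd (p y) * \<tau> + snd (p y) * snd (p y) = 1"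
      using p[OF y] M_det by metis
    have "\<phi> y * \<phi>' y = to_ac (fst (p y) * fst (p y) + fst (p y) * snd (p y) * \<tau> + snd (p y) * snd (p y))"
    proof -
      have "to_ac (snd (p y)) * (to_ac (snd (p y)) * (l * l)) =
        to_ac (snd (p y)) * (to_ac (snd (p y)) * (to_ac \<tau> * l - 1))" by (simp only: l)
      then show ?thesis by (simp add: \<phi>_def \<phi>'_def algebra_simps)
    qed
    then show ?thesis by (simp only: n to_ac_1)
  qed
  \<comment> \<open>By \<open>norm\<close> the value of \<open>\<phi>\<close> determines that of
    \<open>\<phi>'\<close>, and the two recover both coordinates because the difference of the
    eigenvalues has the nonzero square \<open>\<tau>\<^sup>2 - 4\<close>.\<close>
  have inj: "inj_on \<phi> A"
  proof (rule inj_onI)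
    fix y z assume yz: "y \<in> A" "z \<in> A" "\<phi> y = \<phi> z"
    have "\<phi> y \<noteq> 0" using norm[OF yz(1)] by auto
    then have e': "\<phi>' y = \<phi>' z" using norm[OF yz(1)] norm[OF yz(2)] yz(3) by (metis mult_left_cancel)
    have "(l - (to_ac \<tau> - l)) * (l - (to_ac \<tau> - l)) = to_ac (\<tau>\<^sup>2 - 4)"
    proof -
      have "(l - (to_ac \<tau> - l)) * (l - (to_ac \<tau> - l)) = 4 * (l * l) - 4 * to_ac \<tau> * l + to_ac \<tau> * to_ac \<tau>"
        by (simp add: algebra_simps)
      then show ?thesis unfolding l by (simp add: algebra_simps power2_eq_square)
    qed
    moreover have "\<tau>\<^sup>2 - 4 \<noteq> 0" using t by (simp add: \<tau>_def)
    ultimately have "l - (to_ac \<tau> - l) \<noteq> 0" by (metis mult_zero_left to_ac_eq_0_iff)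
    moreover have "(to_ac (snd (p y)) - to_ac (snd (p z))) * (l - (to_ac \<tau> - l)) = (\<phi> y - \<phi> z) - (\<phi>' y - \<phi>' z)"
      unfolding \<phi>_def \<phi>'_def by (simp add: algebra_simps)
    ultimately have "to_ac (snd (p y)) - to_ac (snd (p z)) = 0" using yz(3) e' by simp
    then have s: "snd (p y) = snd (p z)" by simp
    then have "fst (p y) = fst (p z)" using yz(3) by (simp add: \<phi>_def)
    then show "y = z" using s p[OF yz(1)] p[OF yz(2)] by metis
  qed
  have mult: "\<phi> (y ** z) = \<phi> y * \<phi> z" if yz: "y \<in> A" "z \<in> A" for y z
  proof -
    obtain \<alpha> \<beta> \<alpha>' \<beta>' where e: "y = M \<alpha> \<beta>" "z = M \<alpha>' \<beta>'" using p yz by blast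
    have "y ** z \<in> A" using subgroup.m_closed[OF A yz] by simp
    then have yz': "\<phi> (y ** z) = to_ac (\<alpha> * \<alpha>' - \<beta> * \<beta>') + to_ac (\<alpha> * \<beta>' + \<alpha>' * \<beta> + \<beta> * \<beta>' * \<tau>) * l"
      by (rule \<phi>M) (simp add: e M_mult)
    have "\<phi> y * \<phi> z = to_ac (\<alpha> * \<alpha>') + to_ac (\<alpha> * \<beta>' + \<alpha>' * \<beta>) * l + to_ac \<beta> * to_ac \<beta>' * (l * l)"
      using \<phi>M[OF yz(1) e(1)] \<phi>M[OF yz(2) e(2)] by (simp add: algebra_simps)
    then show ?thesis unfolding yz' l by (simp add: algebra_simps)
  qed
  have oneA: "mat2 1 0 0 1 \<in> A" using subgroup.one_closed[OF A] by simp
  have one: "\<phi> (mat2 1 0 0 1) = 1"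
    using \<phi>M[OF oneA, of 1 0] by (simp add: M_def)
  have fin: "finite A" by simp
  obtain g' where g': "g' \<in> \<phi> ` A" "\<And>s. s \<in> \<phi> ` A \<Longrightarrow> \<exists>n. s = g' ^ n"
  proof (rule finite_field_subgroup_cyclic[of "\<phi> ` A"])
    show "1 \<in> \<phi> ` A" using one oneA by (metis imageI)
    show "0 \<notin> \<phi> ` A" using norm by (metis imageE mult_zero_left zero_neq_one)
    show "s * s' \<in> \<phi> ` A" if s: "s \<in> \<phi> ` A" "s' \<in> \<phi> ` A" for s s'
    proof -
      obtain y z where yz: "y \<in> A" "z \<in> A" "s = \<phi> y" "s' = \<phi> z" using s by blast
      then have "s * s' = \<phi> (y ** z)" using mult by simp
      moreover have "y ** z \<in> A" using subgroup.m_closed[OF A yz(1,2)] by simp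
      ultimately show ?thesis by simp
    qed
  qed (use fin in auto)
  then obtain g where g: "g \<in> A" "g' = \<phi> g" by blast
  have powA: "g [^]\<^bsub>SL2\<^esub> n \<in> A" for n :: nat by (rule SL.nat_pow_mem_subgroup[OF A g(1)])
  have pow: "\<phi> (g [^]\<^bsub>SL2\<^esub> n) = \<phi> g ^ n" for n :: nat
    by (induction n) (simp_all add: one mult[OF powA g(1)] mult.commute)
  have "A \<subseteq> generate SL2 {g}"
  proof
    fix y assume y: "y \<in> A"
    obtain n :: nat where "\<phi> y = \<phi> (g [^]\<^bsub>SL2\<^esub> n)" using g'(2)[OF imageI[OF y]] g(2) pow by metis
    then have "y = g [^]\<^bsub>SL2\<^esub> n" using inj y powA by (auto dest: inj_onD)
    moreover have "subgroup (generate SL2 {g}) SL2"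
      using subgroup.subset[OF A] g(1) by (intro SL.generate_is_subgroup) auto
    ultimately show "y \<in> generate SL2 {g}"
      using SL.nat_pow_mem_subgroup by (metis generate.incl insertI1)
  qed
  then show ?thesis using that g(1) by blast
qed

lemma nonscalar:
  assumes "mat2 a b c d \<in> carrier SL2" "mat2 a b c d \<notin> centre SL2"
  shows "b \<noteq> 0 \<or> c \<noteq> 0 \<or> a \<noteq> d"
  using assms by (auto simp: centre_SL2)

text \<open>By \<open>ss\<close> noncentral elements have nonzero discriminant. This yields
  \<open>two_conjugates\<close> and cyclic centralizers, and \<open>abelian\<close> is parallelism,
  so \<open>two_generated\<close> applies.\<close>

lemma semisimple_subgroup_two_generated:
  fixes H :: "('k::{field, finite} ^ 2 ^ 2) set"
  assumes H: "subgroup H SL2" and ZH: "centre SL2 \<subseteq> H"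
    and ss: "\<And>x. x \<in> H \<Longrightarrow> x \<notin> centre SL2 \<Longrightarrow> (trace x)\<^sup>2 \<noteq> 4"
  shows "\<exists>a\<in>H. \<exists>b\<in>H. H = generate SL2 (insert a (insert b (centre SL2)))"
proof -
  interpret SL: group "SL2 :: ('k ^ 2 ^ 2) monoid" by (rule group_special_linear)
  let ?K = "SL2\<lparr>carrier := H\<rparr>"
  note Hc = subgroup.subset[OF H]
  have Zsub: "subgroup (centre SL2) (SL2 :: ('k ^ 2 ^ 2) monoid)"
    using SL.centre_normal by (simp add: normal_imp_subgroup)
  have com: "commutes ?K x y \<longleftrightarrow> x ** y = y ** x" for x y by (simp add: commutes_def)
  have con: "conjugate ?K g y = conjugate SL2 g y" if "g \<in> H" for g y
    using that SL.m_inv_consistent[OF H] by (simp add: conjugate_def)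
  interpret K: group ?K by (rule SL.subgroup_imp_group[OF H])
  interpret abelian_centralizer_group ?K "centre SL2"
  proof (intro abelian_centralizer_group.intro abelian_centralizer_group_axioms.intro K.group_axioms)
    show "subgroup (centre SL2) ?K" using H ZH Zsub by (simp add: SL.subgroup_incl)
    show "commutes ?K z x" if "z \<in> centre SL2" "x \<in> carrier ?K" for z x
      using that Hc by (auto simp: com centre_def)
    show "commutes ?K y w" if x: "x \<in> carrier ?K - centre SL2" and
      "commutes ?K x y" "commutes ?K x w" for x y w
    proof -
      obtain a b c d where xe: "x = mat2 a b c d" by (rule mat2_exhaust)
      obtain e f g h where ye: "y = mat2 e f g h" by (rule mat2_exhaust)
      obtain e' f' g' h' where we: "w = mat2 e' f' g' h'" by (rule mat2_exhaust)
      have "b \<noteq> 0 \<or> c \<noteq> 0 \<or> a \<noteq> d" using x Hc unfolding xe by (intro nonscalar) auto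
      then show ?thesis using mat2_commute_trans that(2,3) unfolding com xe ye we by blast
    qed
    show "\<exists>x'. \<forall>g\<in>carrier ?K. commutes ?K x (conjugate ?K g x) \<longrightarrow> conjugate ?K g x \<in> {x, x'}"
      if x: "x \<in> carrier ?K - centre SL2" for x
    proof -
      obtain a b c d where xe: "x = mat2 a b c d" by (rule mat2_exhaust)
      have xH: "mat2 a b c d \<in> H" "mat2 a b c d \<notin> centre SL2" using x by (auto simp: xe)
      then have xS: "mat2 a b c d \<in> carrier SL2" using Hc by blast
      have "conjugate ?K g x \<in> {x, mat2 d (- b) (- c) a}"
        if g: "g \<in> H" and c: "commutes ?K x (conjugate ?K g x)" for g
      proof -
        have gS: "g \<in> carrier SL2" using g Hc by blast
        obtain e f g' h where ye: "conjugate SL2 g x = mat2 e f g' h" by (rule mat2_exhaust)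
        have "mat2 e f g' h \<in> carrier SL2" using gS xS xe ye by (metis SL.conjugate_closed)
        moreover have "e + h = a + d"
          using trace_conjugate_SL2[OF gS xS] ye xe by simp
        moreover have "(a + d)\<^sup>2 \<noteq> 4" using ss[OF xH] by simp
        ultimately show ?thesis
          using mat2_commuting_conjugates[of b c a d e h f g'] nonscalar[OF xS xH(2)] xS c con[OF g] ye
          by (simp add: com xe)
      qed
      then show ?thesis by auto
    qed
  qed simp
  have "\<exists>c\<in>carrier ?K. cent x \<subseteq> generate ?K (insert c (centre SL2))" if x: "x \<in> carrier ?K - centre SL2" for x
  proof -
    obtain a b c d where xe: "x = mat2 a b c d" by (rule mat2_exhaust)
    have xH: "mat2 a b c d \<in> H" "mat2 a b c d \<notin> centre SL2" using x by (auto simp: xe)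
    then have xS: "mat2 a b c d \<in> carrier SL2" using Hc by blast
    have CH: "cent x \<subseteq> H" by (auto simp: cent_def)
    have "subgroup (cent x) SL2"
      using cent_subgroup[of x] x H by (auto intro: SL.incl_subgroup)
    moreover have "a * d - b * c = 1" using xS by simp
    moreover have "(a + d)\<^sup>2 \<noteq> 4" using ss[OF xH] by simp
    moreover have "mat2 a b c d ** y = y ** mat2 a b c d" if "y \<in> cent x" for y
      using that by (simp add: cent_def com xe)
    ultimately obtain g where g: "g \<in> cent x" "cent x \<subseteq> generate SL2 {g}"
      using centralizer_cyclic[OF _ _ nonscalar[OF xS xH(2)]] by blast
    have "generate SL2 {g} \<subseteq> generate SL2 (insert g (centre SL2))" by (rule SL.mono_generate) blast
    also have "\<dots> = generate ?K (insert g (centre SL2))"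
      using g(1) CH ZH H by (intro SL.generate_consistent[symmetric]) auto
    finally show ?thesis using g CH by auto
  qed
  then obtain a b where ab: "a \<in> H" "b \<in> H" "H = generate ?K (insert a (insert b (centre SL2)))"
    using two_generated by auto
  then have "H = generate SL2 (insert a (insert b (centre SL2)))"
    using ZH H SL.generate_consistent[of "insert a (insert b (centre SL2))" H] by auto
  then show ?thesis using ab(1,2) by blast
qed

section \<open>Unitriangular matrices and triangular subgroups\<close>

lemma of_nat_surj_prime_card:
  fixes r :: "'k::{field, finite}"
  assumes "Factorial_Ring.prime CARD('k)"
  obtains n where "r = of_nat n"
proof -
  \<comment> \<open>The characteristic divides the prime cardinality and is not 1.\<close>
  have "CHAR('k) = CARD('k)"
    using CHAR_dvd_CARD[where 'a = 'k] assms CHAR_not_1[where 'a = 'k] prime_nat_iff by (metis One_nat_def)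
  then have "inj_on (of_nat :: nat \<Rightarrow> 'k) {..<CARD('k)}"
    by (auto simp: inj_on_def of_nat_eq_iff_cong_CHAR cong_def)
  then have "card ((of_nat :: nat \<Rightarrow> 'k) ` {..<CARD('k)}) = CARD('k)" by (simp add: card_image)
  then have "(of_nat :: nat \<Rightarrow> 'k) ` {..<CARD('k)} = UNIV" by (intro card_subset_eq) auto
  then show ?thesis using that by (metis UNIV_I imageE)
qed

lemma unipotent_pow: "mat2 1 s 0 1 [^]\<^bsub>SL2\<^esub> (n::nat) = mat2 1 (of_nat n * s) 0 (1::'k::field)"
  by (induction n) (simp_all add: mat2_mult algebra_simps)

text \<open>In a prime field every element is an integer multiple of \<open>s\<close>, so powers of
  one nontrivial unitriangular matrix exhaust them all.\<close>

lemma unipotent_mem_prime_card: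
  fixes s :: "'k::{field, finite}"
  assumes p: "Factorial_Ring.prime CARD('k)" and H: "subgroup H SL2" and s: "s \<noteq> 0" "mat2 1 s 0 1 \<in> H"
  shows "mat2 1 r 0 1 \<in> H"
proof -
  obtain n where "r / s = of_nat n" by (rule of_nat_surj_prime_card[OF p])
  then have "r = of_nat n * s" using s(1) by (simp add: field_simps)
  then have "mat2 1 r 0 1 = mat2 1 s 0 1 [^]\<^bsub>SL2\<^esub> n" by (simp add: unipotent_pow)
  then show ?thesis using group.nat_pow_mem_subgroup[OF group_special_linear H s(2)] by simp
qed

text \<open>The given matrix reduces to an antidiagonal one, which conjugates upper into lower
  unitriangular matrices; together these generate by elimination.\<close>

lemma SL2_subset_of_unipotents:
  fixes c :: "'k::field"
  assumes H: "subgroup H SL2" and E: "\<And>r. mat2 1 r 0 1 \<in> H"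
    and h: "mat2 a b c d \<in> H" "c \<noteq> 0"
  shows "carrier SL2 \<subseteq> H"
proof -
  have m: "x ** y \<in> H" if "x \<in> H" "y \<in> H" for x y using subgroup.m_closed[OF H that] by simp
  have det: "a * d - b * c = 1" using subgroup.subset[OF H] h(1) by auto
  have "mat2 1 (- a / c) 0 1 ** mat2 a b c d ** mat2 1 (- d / c) 0 1 = mat2 0 (- 1 / c) c 0"
    using h(2) det by (simp add: mat2_mult field_simps)
  then have w: "mat2 0 (- 1 / c) c 0 \<in> H" using m[OF m[OF E h(1)] E] by metis
  have "inv\<^bsub>SL2\<^esub> (mat2 0 (- 1 / c) c 0) = mat2 0 (1 / c) (- c) 0" using h(2) by (simp add: inv_SL2)
  then have w': "mat2 0 (1 / c) (- c) 0 \<in> H" using subgroup.m_inv_closed[OF H w] by simp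
  have F: "mat2 1 0 u 1 \<in> H" for u
  proof -
    have "mat2 0 (- 1 / c) c 0 ** mat2 1 (- u / (c * c)) 0 1 ** mat2 0 (1 / c) (- c) 0 = mat2 1 0 u 1"
      using h(2) by (simp add: mat2_mult field_simps)
    then show ?thesis using m[OF m[OF w E] w'] by metis
  qed
  have nz: "mat2 e f g k \<in> H" if "e * k - f * g = 1" "g \<noteq> 0" for e f g k
  proof -
    have "mat2 1 ((e - 1) / g) 0 1 ** mat2 1 0 g 1 ** mat2 1 ((k - 1) / g) 0 1 = mat2 e f g k"
      using that by (simp add: mat2_mult field_simps)
    then show ?thesis using m[OF m[OF E F] E] by metis
  qed
  show ?thesis
  proof
    fix A :: "'k ^ 2 ^ 2" assume A: "A \<in> carrier SL2"
    obtain e f g k where Ae: "A = mat2 e f g k" by (rule mat2_exhaust)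
    have det': "e * k - f * g = 1" using A Ae by simp
    show "A \<in> H"
    proof (cases "g = 0")
      case True
      \<comment> \<open>Adding the first row to the second makes the lower-left entry
        \<open>e\<close>, which is nonzero; a lower unitriangular factor undoes this.\<close>
      then have "mat2 e f e (f + k) \<in> H" using det' by (intro nz) (auto simp: algebra_simps)
      moreover have "mat2 1 0 (- 1) 1 ** mat2 e f e (f + k) = A" using True by (simp add: Ae mat2_mult)
      ultimately show ?thesis using m F by metis
    qed (use nz det' Ae in simp)
  qed
qed

text \<open>On triangular matrices the upper-left entry is multiplicative with the unitriangular
  ones as kernel. The image is cyclic, and so is the kernel, generated by
  \<open>mat2 1 1 0 1\<close>.\<close>

lemma borel_subgroup_two_generated:
  fixes H :: "('k::{field, finite} ^ 2 ^ 2) set"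
  assumes p: "Factorial_Ring.prime CARD('k)" and H: "subgroup H SL2" and E: "\<And>r. mat2 1 r 0 1 \<in> H"
    and B: "\<And>a b c d. mat2 a b c d \<in> H \<Longrightarrow> c = 0"
  shows "\<exists>a\<in>H. \<exists>b\<in>H. H \<subseteq> generate SL2 {a, b}"
proof -
  interpret SL: group "SL2 :: ('k ^ 2 ^ 2) monoid" by (rule group_special_linear)
  note Hc = subgroup.subset[OF H]
  define \<psi> where "\<psi> A = A $ 1 $ 1" for A :: "'k ^ 2 ^ 2"
  have tri: "\<exists>a b d. A = mat2 a b 0 d \<and> a * d = 1" if "A \<in> H" for A
  proof -
    obtain a b c d where "A = mat2 a b c d" by (rule mat2_exhaust)
    moreover from this have "c = 0" using B that by blast
    ultimately show ?thesis using that Hc by auto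
  qed
  have mult: "\<psi> (A ** A') = \<psi> A * \<psi> A'" if "A \<in> H" "A' \<in> H" for A A'
    using tri[OF that(1)] tri[OF that(2)] by (auto simp: \<psi>_def mat2_mult)
  obtain s where s: "s \<in> \<psi> ` H" "\<And>x. x \<in> \<psi> ` H \<Longrightarrow> \<exists>n. x = s ^ n"
  proof (rule finite_field_subgroup_cyclic[of "\<psi> ` H"])
    show "1 \<in> \<psi> ` H" using E[of 0] by (force simp: \<psi>_def)
    show "0 \<notin> \<psi> ` H" using tri by (force simp: \<psi>_def)
    show "x * y \<in> \<psi> ` H" if xy: "x \<in> \<psi> ` H" "y \<in> \<psi> ` H" for x y
    proof -
      obtain A A' where A: "A \<in> H" "A' \<in> H" "x = \<psi> A" "y = \<psi> A'" using xy by blast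
      then have "x * y = \<psi> (A ** A')" using mult by simp
      moreover have "A ** A' \<in> H" using subgroup.m_closed[OF H A(1,2)] by simp
      ultimately show ?thesis by simp
    qed
  qed auto
  then obtain g where g: "g \<in> H" "s = \<psi> g" by blast
  let ?u = "mat2 1 1 0 (1 :: 'k)"
  have powH: "g [^]\<^bsub>SL2\<^esub> n \<in> H" for n :: nat by (rule SL.nat_pow_mem_subgroup[OF H g(1)])
  have pow: "\<psi> (g [^]\<^bsub>SL2\<^esub> n) = \<psi> g ^ n" for n :: nat
  proof (induction n)
    case (Suc n)
    then show ?case using mult[OF powH g(1)] by simp
  qed (simp add: \<psi>_def)
  have gu: "{g, ?u} \<subseteq> carrier SL2" using g(1) Hc E by auto
  have sub: "subgroup (generate SL2 {g, ?u}) SL2" by (rule SL.generate_is_subgroup[OF gu])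
  have "H \<subseteq> generate SL2 {g, ?u}"
  proof
    fix A assume A: "A \<in> H"
    obtain n :: nat where n: "\<psi> A = \<psi> (g [^]\<^bsub>SL2\<^esub> n)" using s(2)[OF imageI[OF A]] g(2) pow by metis
    obtain a b d where Ae: "A = mat2 a b 0 d" "a * d = 1" using tri[OF A] by blast
    obtain a' b' d' where ge: "g [^]\<^bsub>SL2\<^esub> n = mat2 a' b' 0 d'" "a' * d' = 1" using tri[OF powH] by blast
    have aa: "a' = a" using n unfolding Ae ge by (simp add: \<psi>_def)
    then have "a * d' = a * d" "a \<noteq> 0" using Ae ge by auto
    then have dd: "d' = d" by simp
    have "a * (d * (b - b')) + b' = b" by (simp add: Ae(2) flip: mult.assoc)
    then have "A = g [^]\<^bsub>SL2\<^esub> n ** mat2 1 (d * (b - b')) 0 1"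
      unfolding Ae(1) ge(1) aa dd mat2_mult
      by (simp only: mult_1_right mult_zero_right mult_zero_left add_0_left add_0_right)
    moreover have "mat2 1 (d * (b - b')) 0 1 \<in> generate SL2 {g, ?u}"
      by (rule unipotent_mem_prime_card[OF p sub, of 1]) (auto intro: generate.incl)
    moreover have "g [^]\<^bsub>SL2\<^esub> n \<in> generate SL2 {g, ?u}"
      by (rule SL.nat_pow_mem_subgroup[OF sub]) (auto intro: generate.incl)
    ultimately show "A \<in> generate SL2 {g, ?u}" using subgroup.m_closed[OF sub] by fastforce
  qed
  then show ?thesis using g(1) E by blast
qed

text \<open>Trace 2 and determinant 1 make 1 a double eigenvalue, and a noncentral such matrix is a
  nontrivial Jordan block.\<close>

lemma unipotent_conjugate:
  fixes x :: "'k::field ^ 2 ^ 2"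
  assumes x: "x \<in> carrier SL2" "x \<notin> centre SL2" and t: "trace x = 2"
  obtains P s where "P \<in> carrier SL2" "s \<noteq> 0" "conjugate SL2 P x = mat2 1 s 0 1"
proof -
  interpret SL: group "SL2 :: ('k ^ 2 ^ 2) monoid" by (rule group_special_linear)
  obtain a b c d where xe: "x = mat2 a b c d" by (rule mat2_exhaust)
  have ns: "b \<noteq> 0 \<or> c \<noteq> 0 \<or> a \<noteq> d" using x unfolding xe by (rule nonscalar)
  have d: "d = 2 - a" using t by (simp add: xe algebra_simps)
  have "a * d - b * c = 1" using x(1) xe by simp
  then have bc: "b * c = - ((a - 1) * (a - 1))" unfolding d by (simp add: algebra_simps)
  show ?thesis
  proof (cases "c = 0")
    case True
    then have "a = 1" using bc by simp
    then have "conjugate SL2 (mat2 1 0 0 1) x = mat2 1 b 0 1" "b \<noteq> 0"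
      using True ns SL.conjugate_one[OF x(1)] by (simp_all add: xe d)
    then show ?thesis by (intro that[of "mat2 1 0 0 1" b]) simp_all
  next
    case False
    have b: "b = - ((a - 1) * (a - 1)) / c" using bc False by (simp add: field_simps)
    \<comment> \<open>The second row of \<open>P\<close> is a left eigenvector of \<open>x\<close>
      for the eigenvalue 1; the first completes it to determinant 1.\<close>
    define P where "P = mat2 0 (1 / c) (- c) (a - 1)"
    have "P ** x = mat2 1 (- 1 / c) 0 1 ** P"
      unfolding P_def xe mat2_mult mat2_eq_iff using False by (simp add: b d field_simps)
    moreover have P: "P \<in> carrier SL2" using False by (simp add: P_def)
    moreover have "P ** x \<in> carrier SL2" using SL.m_closed[OF P x(1)] by simp
    ultimately have "P ** x \<otimes>\<^bsub>SL2\<^esub> inv\<^bsub>SL2\<^esub> P = mat2 1 (- 1 / c) 0 1"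
      by (subst SL.inv_solve_right') (simp_all only: SL2_mult mat2_in_SL2, simp)
    then have "conjugate SL2 P x = mat2 1 (- 1 / c) 0 1" by (simp add: conjugate_def)
    then show ?thesis using that[OF P, of "- 1 / c"] False by simp
  qed
qed

section \<open>Proper subgroups of SL(2, p)\<close>

lemma (in group) conjugate_hom:
  "g \<in> carrier G \<Longrightarrow> group_hom G G (conjugate G g)"
  by unfold_locales (auto simp: hom_def conjugate_distrib)

text \<open>A noncentral element whose trace squares to 4 is, up to sign, a nontrivial unipotent;
  having one leads to the triangular case, having none to the semisimple one.\<close>

theorem SL2_proper_subgroup_two_generated:
  fixes H :: "('k::{field, finite} ^ 2 ^ 2) set"
  assumes p: "Factorial_Ring.prime CARD('k)" and H: "subgroup H SL2" and ZH: "centre SL2 \<subseteq> H"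
    and proper: "H \<noteq> carrier SL2"
  shows "\<exists>a\<in>H. \<exists>b\<in>H. H = generate SL2 (insert a (insert b (centre SL2)))"
proof (cases "\<exists>x\<in>H. x \<notin> centre SL2 \<and> (trace x)\<^sup>2 = 4")
  case False
  then show ?thesis using semisimple_subgroup_two_generated[OF H ZH] by blast
next
  case True
  interpret SL: group "SL2 :: ('k ^ 2 ^ 2) monoid" by (rule group_special_linear)
  note Hc = subgroup.subset[OF H]
  obtain x where x: "x \<in> H" "x \<notin> centre SL2" "(trace x)\<^sup>2 = 4" using True by blast
  \<comment> \<open>Multiplication by the central matrix -1 turns trace -2 into trace 2.\<close>
  have "\<exists>y\<in>H. y \<notin> centre SL2 \<and> trace y = 2"
  proof -
    have "(trace x - 2) * (trace x + 2) = 0" using x(3) by (simp add: algebra_simps power2_eq_square)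
    then have "trace x = 2 \<or> trace x = - 2" by (auto simp: eq_neg_iff_add_eq_0)
    then show ?thesis
    proof
      assume t: "trace x = - 2"
      obtain a b c d where xe: "x = mat2 a b c d" by (rule mat2_exhaust)
      have "mat2 (- 1) 0 0 (- 1) \<in> H" using ZH by (auto simp: centre_SL2)
      then have "mat2 (- 1) 0 0 (- 1) ** x \<in> H" using subgroup.m_closed[OF H _ x(1)] by fastforce
      moreover have "mat2 (- 1) 0 0 (- 1) ** x = mat2 (- a) (- b) (- c) (- d)" by (simp add: xe mat2_mult)
      moreover have "mat2 (- a) (- b) (- c) (- d) \<notin> centre SL2" using x(2) by (auto simp: xe centre_SL2)
      moreover have "trace (mat2 (- a) (- b) (- c) (- d)) = 2"
        using t xe by (metis minus_add_distrib minus_minus trace_mat2)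
      ultimately show ?thesis by metis
    qed (use x in blast)
  qed
  then obtain y where y: "y \<in> H" "y \<notin> centre SL2" "trace y = 2" by blast
  obtain P s where P: "P \<in> carrier SL2" "s \<noteq> 0" "conjugate SL2 P y = mat2 1 s 0 1"
    using unipotent_conjugate[OF _ y(2,3)] y(1) Hc by blast
  interpret c: group_hom SL2 SL2 "conjugate SL2 P" by (rule SL.conjugate_hom[OF P(1)])
  interpret c': group_hom SL2 SL2 "conjugate SL2 (inv\<^bsub>SL2\<^esub> P)" by (rule SL.conjugate_hom) (simp add: P(1))
  have inv: "conjugate SL2 (inv\<^bsub>SL2\<^esub> P) (conjugate SL2 P A) = A" if "A \<in> carrier SL2" for A
    using P(1) that by simp
  \<comment> \<open>This conjugate contains a standard unitriangular matrix; the generators found in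
    it are carried back at the end.\<close>
  define K where "K = conjugate SL2 P ` H"
  have K: "subgroup K SL2" unfolding K_def using H by (rule c.subgroup_img_is_subgroup)
  note Kc = subgroup.subset[OF K]
  have HK: "H = conjugate SL2 (inv\<^bsub>SL2\<^esub> P) ` K"
  proof -
    have "(\<lambda>A. conjugate SL2 (inv\<^bsub>SL2\<^esub> P) (conjugate SL2 P A)) ` H = (\<lambda>A. A) ` H"
      by (rule image_cong[OF refl]) (use inv Hc in blast)
    then show ?thesis by (simp add: K_def image_image)
  qed
  have E: "mat2 1 r 0 1 \<in> K" for r
    by (rule unipotent_mem_prime_card[OF p K P(2)]) (use P(3) y(1) in \<open>auto simp: K_def simp flip: P(3)\<close>)
  have "\<not> carrier SL2 \<subseteq> K"
  proof
    assume "carrier SL2 \<subseteq> K"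
    then have "A \<in> H" if A: "A \<in> carrier SL2" for A
    proof -
      have "conjugate SL2 P A \<in> K" using \<open>carrier SL2 \<subseteq> K\<close> A P(1) by blast
      then have "conjugate SL2 (inv\<^bsub>SL2\<^esub> P) (conjugate SL2 P A) \<in> H" unfolding HK by (rule imageI)
      then show ?thesis by (simp only: inv[OF A])
    qed
    then show False using proper Hc by blast
  qed
  then have "c = 0" if "mat2 a b c d \<in> K" for a b c d
    using SL2_subset_of_unipotents[OF K E that] by blast
  then obtain a b where ab: "a \<in> K" "b \<in> K" "K \<subseteq> generate SL2 {a, b}"
    using borel_subgroup_two_generated[OF p K E] by blast
  let ?c = "conjugate SL2 (inv\<^bsub>SL2\<^esub> P)"
  have "H \<subseteq> ?c ` generate SL2 {a, b}" using HK ab(3) by blast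
  also have "\<dots> = generate SL2 {?c a, ?c b}"
    using c'.generate_img[of "{a, b}"] ab(1,2) Kc by auto
  also have "\<dots> \<subseteq> generate SL2 (insert (?c a) (insert (?c b) (centre SL2)))"
    by (rule SL.mono_generate) blast
  finally have "H \<subseteq> generate SL2 (insert (?c a) (insert (?c b) (centre SL2)))" .
  moreover have c: "?c a \<in> H" "?c b \<in> H" using ab(1,2) HK by auto
  then have "generate SL2 (insert (?c a) (insert (?c b) (centre SL2))) \<subseteq> H"
    using ZH H by (intro SL.generate_subgroup_incl) auto
  ultimately show ?thesis using c by blast
qed

section \<open>From SL(2) to PSL(2)\<close>

lemma psi_PSL2_le_3:
  fixes G :: "('a, 'b) monoid_scheme"
  assumes G: "group G" and fin: "finite (carrier G)"
    and p: "Factorial_Ring.prime CARD('k::{field, finite})" and iso: "G \<cong> PSL2 TYPE('k)"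
  shows "psi G \<le> 3"
proof -
  interpret group G by (rule G)
  interpret SL: group "SL2 :: ('k ^ 2 ^ 2) monoid" by (rule group_special_linear)
  interpret Z: normal "centre SL2" "SL2 :: ('k ^ 2 ^ 2) monoid" by (rule SL.centre_normal)
  let ?Z = "centre (SL2 :: ('k ^ 2 ^ 2) monoid)"
  obtain h where h: "h \<in> iso (PSL2 TYPE('k)) G"
    using iso group.iso_sym[OF G] unfolding is_iso_def by blast
  define \<phi> where "\<phi> A = h (?Z #>\<^bsub>SL2\<^esub> A)" for A
  have "\<phi> \<in> hom SL2 G"
  proof -
    have "h \<circ> (\<lambda>A. ?Z #>\<^bsub>SL2\<^esub> A) \<in> hom SL2 G"
      by (rule Group.hom_compose[OF Z.r_coset_hom_Mod]) (use h in \<open>simp add: iso_def PSL2_def\<close>)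
    then show ?thesis by (simp add: \<phi>_def[abs_def] comp_def)
  qed
  then interpret \<phi>: group_hom SL2 G \<phi> by unfold_locales
  have surj: "\<phi> ` carrier SL2 = carrier G"
  proof -
    have "\<phi> ` carrier SL2 = h ` carrier (PSL2 TYPE('k))"
      by (auto simp: \<phi>_def PSL2_def FactGroup_def RCOSETS_def)
    then show ?thesis using h by (simp add: iso_def bij_betw_def)
  qed
  have \<phi>Z: "\<phi> z = \<one>\<^bsub>G\<^esub>" if z: "z \<in> ?Z" for z
  proof -
    have "?Z #>\<^bsub>SL2\<^esub> z = ?Z"
      by (rule SL.coset_join2[OF _ Z.is_subgroup z]) (use z Z.subset in blast)
    also have "?Z = ?Z #>\<^bsub>SL2\<^esub> \<one>\<^bsub>SL2\<^esub>"
      by (rule SL.coset_mult_one[OF Z.subset, symmetric])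
    finally have "?Z #>\<^bsub>SL2\<^esub> z = ?Z #>\<^bsub>SL2\<^esub> \<one>\<^bsub>SL2\<^esub>" .
    then show ?thesis using \<phi>.hom_one by (simp only: \<phi>_def)
  qed
  show ?thesis
  proof (rule psi_le[OF fin])
    fix M y assume M: "maximal_subgroup G M" and y: "y \<in> carrier G" "y \<notin> M"
    have sM: "subgroup M G" and Mc: "M \<noteq> carrier G" using M by (auto simp: maximal_subgroup_def)
    \<comment> \<open>The preimage of \<open>M\<close> is proper and contains the centre, so two
      elements generate it modulo the centre.\<close>
    define H where "H = {A \<in> carrier SL2. \<phi> A \<in> M}"
    have H: "subgroup H SL2"
    proof (rule SL.subgroupI)
      show "H \<noteq> {}" using \<phi>.hom_one subgroup.one_closed[OF sM] SL.one_closed unfolding H_def by fastforce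
      show "inv\<^bsub>SL2\<^esub> A \<in> H" if "A \<in> H" for A
        using that subgroup.m_inv_closed[OF sM] by (simp add: H_def)
      show "A \<otimes>\<^bsub>SL2\<^esub> B \<in> H" if "A \<in> H" "B \<in> H" for A B
        using that subgroup.m_closed[OF sM] by (simp add: H_def del: SL2_mult)
    qed (simp add: H_def)
    have \<phi>H: "\<phi> ` H = M" using surj subgroup.subset[OF sM] by (auto simp: H_def)
    have "?Z \<subseteq> H" using Z.subset \<phi>Z subgroup.one_closed[OF sM] by (auto simp: H_def)
    moreover have "H \<noteq> carrier SL2" using \<phi>H surj Mc by auto
    ultimately obtain a b where ab: "a \<in> H" "b \<in> H" "H = generate SL2 (insert a (insert b ?Z))"
      using SL2_proper_subgroup_two_generated[OF p H] by blast
    have "insert a (insert b ?Z) \<subseteq> carrier SL2" using ab(1,2) Z.subset by (auto simp: H_def)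
    then have "M = generate G (\<phi> ` insert a (insert b ?Z))"
      using \<phi>.generate_img[of "insert a (insert b ?Z)"] \<phi>H ab(3) by metis
    \<comment> \<open>The centre maps to the identity, so two images and the identity
      suffice.\<close>
    also have "\<dots> \<subseteq> generate G {\<phi> a, \<phi> b, \<one>\<^bsub>G\<^esub>}" using \<phi>Z by (intro mono_generate) auto
    finally have gen: "M \<subseteq> generate G {\<phi> a, \<phi> b, \<one>\<^bsub>G\<^esub>}" .
    have T: "{\<phi> a, \<phi> b} \<subseteq> M" using ab(1,2) \<phi>H by blast
    have Tc: "insert y {\<phi> a, \<phi> b} \<subseteq> carrier G" using T y(1) subgroup.subset[OF sM] by blast
    \<comment> \<open>A maximal subgroup containing the pair contains \<open>M\<close>, hence equals
      \<open>M\<close>, and so misses \<open>y\<close>.\<close>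
    have "generates G (insert y {\<phi> a, \<phi> b})"
    proof (subst generates_iff_no_maximal[OF fin Tc], intro allI impI notI)
      fix M' assume M': "maximal_subgroup G M'" and sub: "insert y {\<phi> a, \<phi> b} \<subseteq> M'"
      have sM': "subgroup M' G" "M' \<noteq> carrier G" using M' by (auto simp: maximal_subgroup_def)
      have "generate G {\<phi> a, \<phi> b, \<one>\<^bsub>G\<^esub>} \<subseteq> M'"
        using sub subgroup.one_closed[OF sM'(1)] by (intro generate_subgroup_incl sM'(1)) auto
      then have "M \<subseteq> M'" using gen by blast
      then have "M' = M" using M sM' unfolding maximal_subgroup_def by blast
      then show False using sub y(2) by blast
    qed
    moreover have "card {\<phi> a, \<phi> b} < 3" by (simp add: card_insert_if)
    ultimately show "\<exists>T\<subseteq>M. finite T \<and> card T < 3 \<and> generates G (insert y T)"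
      using T by (intro exI[of _ "{\<phi> a, \<phi> b}"]) auto
  qed simp
qed

theorem proposition2p14:
  fixes G :: "('a, 'b) monoid_scheme" and p :: nat
  assumes "group G" and "finite (carrier G)"
  shows "(carrier G \<noteq> {\<one>\<^bsub>G\<^esub>} \<longrightarrow> psi G \<le> mu G) \<and>
    (Factorial_Ring.prime p \<and> CARD('k::{field, finite}) = p \<and> G \<cong> PSL2 TYPE('k) \<longrightarrow>
       (p \<notin> {7, 11, 19, 31} \<longrightarrow> psi G \<le> 3) \<and>
       (p \<in> {7, 11, 19, 31} \<longrightarrow> psi G \<le> 4))"
proof (intro conjI impI)
  show "psi G \<le> mu G" if "carrier G \<noteq> {\<one>\<^bsub>G\<^esub>}"
    using group.psi_le_mu[OF assms] that .
  \<comment> \<open>The bound 3 holds for every prime and yields both cases.\<close>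
  have "psi G \<le> 3" if "Factorial_Ring.prime p \<and> CARD('k) = p \<and> G \<cong> PSL2 TYPE('k)"
    using psi_PSL2_le_3[OF assms, where 'k = 'k] that by blast
  then show "psi G \<le> 3" "psi G \<le> 4" if "Factorial_Ring.prime p \<and> CARD('k) = p \<and> G \<cong> PSL2 TYPE('k)"
    using that by fastforce+
qed

end
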